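(* Let $\theta_0\in\mathbb{R}_+$ be the true parameter, let $\varrho\in\mathcal{Q}$ be positive and continuous in a neighborhood of $\theta_0$, and let $f$ be a non-negative, Borel-measurable function on $\mathbb{R}$. Suppose that $\varrho$ and $f$ satisfy: (C1) there exists $\alpha\in(0,1)$ such that $\int_{\mathbb{R}}f(x)e^{-\alpha x^2/2}\,dx<\infty$; (C2) for any $\delta>0$, $$\lim_{N\to\infty}\int_{\{|\lambda|>\sqrt{I_N}\delta\}}f(\lambda)\,\varrho\Big(\widehat\theta_N+\frac{\lambda}{\sqrt{I_N}}\Big)e^{-\lambda^2/2}\,d\lambda=0,\quad\mathbb{P}\text{-a.s.}$$ Then $$\lim_{N\to\infty}\int_{\mathbb{R}}f(\lambda)\Big|\widetilde p(\lambda\,|\,U_N)-\frac{e^{-\lambda^2/2}}{\sqrt{2\pi}}\Big|\,d\lambda=0,\quad\mathbb{P}\text{-a.s.}$$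
   Context: $\mathbb{R}_+:=(0,\infty)$. $(\Omega,\mathscr{F},\{\mathscr{F}_t\},\mathbb{P})$ is a stochastic basis satisfying the usual assumptions, with independent standard Brownian motions $\{w_k\}_{k\in\mathbb{N}}$. $\{\mu_k\}\subset(0,\infty)$ with $\mu_k\to\infty$ (the eigenvalues of a positive definite self-adjoint operator $A$ on a separable Hilbert space), $\{q_k\}\subset(0,\infty)$, $\sigma>0$ and $T>0$ are fixed and known. For $\theta\in\mathbb{R}_+$, $u_k^\theta$ is the $k$-th Fourier mode of the solution of $du+\theta Au\,dt=\sigma\sum_ku_kh_kq_k\,dw_k$ ($h_k$ the eigenvectors of $A$), i.e. $du_k^\theta=-\theta\mu_ku_k^\theta\,dt+\sigma q_ku_k^\theta\,dw_k$, so $u_k^\theta(t)=u_k(0)\exp\big(-(\theta\mu_k+\tfrac12\sigma^2q_k^2)t+\sigma q_kw_k(t)\big)$, $t\in[0,T]$, with $\mathscr{F}_0$-measurable $u_k(0)\ne0$ not depending on $\theta$. Standing assumption: the well-posedness condition of the equation holds for at least one parameter value, i.e. there exist $\bar\theta>0$, $N_0\in\mathbb{N}$, $c>0$ with $2\bar\theta-\sigma^2q_k^2/\mu_k\ge c$ for all $k\ge N_0$. The observation is $U_N=(u_1,\dots,u_N)$ on $[0,T]$ with $u_k:=u_k^{\theta_0}$. The Fisher information is $I_N:=\frac{T}{\sigma^2}\sum_{k=1}^N\mu_k^2q_k^{-2}$ and $\widehat\theta_N:=-\dfrac{\sum_{k=1}^N\mu_kq_k^{-2}\int_0^T\frac{du_k(t)}{u_k(t)}}{T\sum_{k=1}^N\mu_k^2q_k^{-2}}$.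 $\mathcal{Q}$ is the set of all non-negative, non-trivial (Borel) functions on $\mathbb{R}_+$ (priors, possibly improper). The posterior density is $$p(\theta\,|\,U_N)=\frac{e^{-I_N(\theta-\widehat\theta_N)^2/2}\varrho(\theta)}{\int_{\mathbb{R}_+}e^{-I_N(\eta-\widehat\theta_N)^2/2}\varrho(\eta)\,d\eta},\quad\theta\in\mathbb{R}_+,$$ it being understood that the denominator is finite and positive for every $N$, a.s. Extend $\varrho$ by $\varrho(\theta)=0$ for $\theta\le0$. The posterior density of the normalized difference $\sqrt{I_N}(\Theta-\widehat\theta_N)$ (with $\Theta$ the randomized parameter) is $$\widetilde p(\lambda\,|\,U_N)=C_N^{-1}\varrho\Big(\frac{\lambda}{\sqrt{I_N}}+\widehat\theta_N\Big)e^{-\lambda^2/2},\quad\lambda\in\mathbb{R},\qquad C_N:=\int_{\mathbb{R}}\varrho\Big(\frac{\lambda}{\sqrt{I_N}}+\widehat\theta_N\Big)e^{-\lambda^2/2}\,d\lambda.$$ *)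

theory Defs
  imports "HOL-Probability.Probability"
begin

section \<open>Stochastic bases and Brownian motion\<close>

text \<open>Time is \<open>[0, \<infinity>)\<close>, embedded in the reals; the value of \<open>F\<close> at negative times is
  never used (hence the \<open>max 0\<close>, which lets the library's notion of a filtration apply).\<close>

definition stochastic_basis :: "'a measure \<Rightarrow> (real \<Rightarrow> 'a measure) \<Rightarrow> bool" where
  "stochastic_basis M F \<longleftrightarrow>
     prob_space M \<and>
     filtration (space M) (\<lambda>t. F (max 0 t)) \<and>
     (\<forall>t\<ge>0. subalgebra M (F t)) \<and>
     \<comment> \<open>usual assumptions: right-continuity and completeness\<close>
     (\<forall>t\<ge>0. sets (F t) = (\<Inter>s\<in>{t<..}. sets (F s))) \<and>
     (\<forall>Z\<in>null_sets M. \<forall>A\<subseteq>Z. A \<in> sets (F 0))"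

definition brownian_motion ::
  "'a measure \<Rightarrow> (real \<Rightarrow> 'a measure) \<Rightarrow> (real \<Rightarrow> 'a \<Rightarrow> real) \<Rightarrow> bool" where
  "brownian_motion M F W \<longleftrightarrow>
     (\<forall>t\<ge>0. W t \<in> borel_measurable (F t)) \<and>
     (AE \<omega> in M. W 0 \<omega> = 0) \<and>
     (AE \<omega> in M. continuous_on {0..} (\<lambda>t. W t \<omega>)) \<and>
     (\<forall>s\<ge>0. \<forall>t>s.
        distributed M lborel (\<lambda>\<omega>. W t \<omega> - W s \<omega>) (\<lambda>x. ennreal (normal_density 0 (sqrt (t - s)) x)) \<and>
        prob_space.indep_set M (sets (F s))
          (sets (vimage_algebra (space M) (\<lambda>\<omega>. W t \<omega> - W s \<omega>) borel)))"

text \<open>Independence of whole processes: each process is a random element of the product space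
  \<open>\<real>\<^bsup>[0,\<infinity>)\<^esup>\<close>.\<close>

definition indep_processes ::
  "'a measure \<Rightarrow> ('i \<Rightarrow> real \<Rightarrow> 'a \<Rightarrow> real) \<Rightarrow> 'i set \<Rightarrow> bool" where
  "indep_processes M W I \<longleftrightarrow>
     prob_space.indep_vars M (\<lambda>_. PiM {0..} (\<lambda>_. borel)) (\<lambda>k \<omega>. \<lambda>t\<in>{0..}. W k t \<omega>) I"

section \<open>Stochastic integral\<close>

definition tendsto_in_prob ::
  "'a measure \<Rightarrow> (nat \<Rightarrow> 'a \<Rightarrow> real) \<Rightarrow> ('a \<Rightarrow> real) \<Rightarrow> bool" where
  "tendsto_in_prob M Y Z \<longleftrightarrow>
     (\<forall>\<epsilon>>0. (\<lambda>n. measure M {\<omega> \<in> space M. \<bar>Y n \<omega> - Z \<omega>\<bar> > \<epsilon>}) \<longlonglongrightarrow> 0)"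

text \<open>A simple predictable process on \<open>(0,T]\<close> is
  \<open>\<Sum>i<m. \<xi> i * indicator {\<tau> i<..\<tau> (Suc i)}\<close> with \<open>0 = \<tau> 0 \<le> \<dots> \<le> \<tau> m = T\<close> and
  \<open>\<xi> i\<close> measurable with respect to \<open>F (\<tau> i)\<close>; it is represented by the data \<open>m\<close>, \<open>\<tau>\<close>, \<open>\<xi>\<close>.\<close>

definition simple_predictable ::
  "(real \<Rightarrow> 'a measure) \<Rightarrow> real \<Rightarrow> nat \<Rightarrow> (nat \<Rightarrow> real) \<Rightarrow> (nat \<Rightarrow> 'a \<Rightarrow> real) \<Rightarrow> bool" where
  "simple_predictable F T m \<tau> \<xi> \<longleftrightarrow>
     \<tau> 0 = 0 \<and> \<tau> m = T \<and> (\<forall>i<m. \<tau> i \<le> \<tau> (Suc i)) \<and> (\<forall>i<m. \<xi> i \<in> borel_measurable (F (\<tau> i)))"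

definition simple_process ::
  "nat \<Rightarrow> (nat \<Rightarrow> real) \<Rightarrow> (nat \<Rightarrow> 'a \<Rightarrow> real) \<Rightarrow> real \<Rightarrow> 'a \<Rightarrow> real" where
  "simple_process m \<tau> \<xi> t \<omega> = (\<Sum>i<m. \<xi> i \<omega> * indicator {\<tau> i<..\<tau> (Suc i)} t)"

definition simple_integral ::
  "nat \<Rightarrow> (nat \<Rightarrow> real) \<Rightarrow> (nat \<Rightarrow> 'a \<Rightarrow> real) \<Rightarrow> (real \<Rightarrow> 'a \<Rightarrow> real) \<Rightarrow> 'a \<Rightarrow> real" where
  "simple_integral m \<tau> \<xi> X \<omega> = (\<Sum>i<m. \<xi> i \<omega> * (X (\<tau> (Suc i)) \<omega> - X (\<tau> i) \<omega>))"

text \<open>\<open>has_stochastic_integral M F T H X J\<close>: the random variable \<open>J\<close> is a version of the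
  It\^o integral of a continuous adapted process \<open>H\<close> against a continuous semimartingale \<open>X\<close>
  over \<open>[0,T]\<close>. As usual, the integral is the extension of the elementary integral that is
  continuous from uniform convergence in probability to convergence in probability; for such \<open>H\<close>,
  approximating sequences of simple processes always exist (freeze \<open>H\<close> at the points of finer and
  finer partitions), so \<open>J\<close> is determined up to almost sure equality. The exceptional
  sets in the convergence condition are measurable because \<open>F 0\<close> contains all subsets of null sets.\<close>

definition has_stochastic_integral ::
  "'a measure \<Rightarrow> (real \<Rightarrow> 'a measure) \<Rightarrow> real \<Rightarrow> (real \<Rightarrow> 'a \<Rightarrow> real) \<Rightarrow> (real \<Rightarrow> 'a \<Rightarrow> real)
     \<Rightarrow> ('a \<Rightarrow> real) \<Rightarrow> bool" where
  "has_stochastic_integral M F T H X J \<longleftrightarrow>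
     (\<forall>t\<in>{0..T}. H t \<in> borel_measurable (F t)) \<and>
     (AE \<omega> in M. continuous_on {0..T} (\<lambda>t. H t \<omega>)) \<and>
     J \<in> borel_measurable M \<and>
     (\<forall>m \<tau> \<xi>.
        (\<forall>n. simple_predictable F T (m n) (\<tau> n) (\<xi> n)) \<and>
        (\<forall>\<epsilon>>0. (\<lambda>n. measure M {\<omega> \<in> space M. \<exists>t\<in>{0<..T}.
             \<bar>simple_process (m n) (\<tau> n) (\<xi> n) t \<omega> - H t \<omega>\<bar> > \<epsilon>}) \<longlonglongrightarrow> 0)
        \<longrightarrow> tendsto_in_prob M (\<lambda>n. simple_integral (m n) (\<tau> n) (\<xi> n) X) J)"

section \<open>The Fourier modes and the estimator\<close>

text \<open>Solution of \<open>du = - \<theta> \<mu> u dt + \<sigma> q u dW\<close>, \<open>u(0) = u0\<close>.\<close>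

definition fourier_mode ::
  "real \<Rightarrow> real \<Rightarrow> real \<Rightarrow> real \<Rightarrow> ('a \<Rightarrow> real) \<Rightarrow> (real \<Rightarrow> 'a \<Rightarrow> real) \<Rightarrow> real \<Rightarrow> 'a \<Rightarrow> real" where
  "fourier_mode \<sigma> \<mu> q \<theta> u0 W t \<omega> =
     u0 \<omega> * exp (- (\<theta> * \<mu> + \<sigma>\<^sup>2 * q\<^sup>2 / 2) * t + \<sigma> * q * W t \<omega>)"

text \<open>Modes are numbered from 1.\<close>

definition fisher_info :: "real \<Rightarrow> real \<Rightarrow> (nat \<Rightarrow> real) \<Rightarrow> (nat \<Rightarrow> real) \<Rightarrow> nat \<Rightarrow> real" where
  "fisher_info T \<sigma> \<mu> q N = T / \<sigma>\<^sup>2 * (\<Sum>k=1..N. (\<mu> k)\<^sup>2 / (q k)\<^sup>2)"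

text \<open>Here \<open>J k\<close> stands for (a version of) the integral of \<open>1 / u k\<close> against \<open>u k\<close> over
  \<open>[0,T]\<close>.\<close>

definition theta_hat ::
  "real \<Rightarrow> (nat \<Rightarrow> real) \<Rightarrow> (nat \<Rightarrow> real) \<Rightarrow> (nat \<Rightarrow> 'a \<Rightarrow> real) \<Rightarrow> nat \<Rightarrow> 'a \<Rightarrow> real" where
  "theta_hat T \<mu> q J N \<omega> =
     - (\<Sum>k=1..N. \<mu> k / (q k)\<^sup>2 * J k \<omega>) / (T * (\<Sum>k=1..N. (\<mu> k)\<^sup>2 / (q k)\<^sup>2))"

section \<open>Priors and posteriors\<close>

text \<open>A prior is a function on \<open>(0,\<infinity>)\<close>; its values on \<open>(-\<infinity>,0]\<close> are irrelevant, and
  \<open>prior_ext\<close> replaces them by 0.\<close>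

definition priors :: "(real \<Rightarrow> real) set" where
  "priors = {\<rho>. \<rho> \<in> borel_measurable (restrict_space borel {0<..}) \<and>
                (\<forall>\<theta>>0. \<rho> \<theta> \<ge> 0) \<and> (\<exists>\<theta>>0. \<rho> \<theta> \<noteq> 0)}"

definition prior_ext :: "(real \<Rightarrow> real) \<Rightarrow> real \<Rightarrow> real" where
  "prior_ext \<rho> \<theta> = (if \<theta> > 0 then \<rho> \<theta> else 0)"

text \<open>In the following, \<open>I\<close> is the Fisher information and \<open>h\<close> the value of the estimator.
  \<open>posterior_denom\<close> is the denominator of the posterior density of the parameter,
  \<open>posterior_const\<close> and \<open>posterior_normalized\<close> are the normalizing constant and the
  posterior density of the normalized difference.\<close>

definition posterior_denom :: "(real \<Rightarrow> real) \<Rightarrow> real \<Rightarrow> real \<Rightarrow> ennreal" where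
  "posterior_denom \<rho> I h =
     (\<integral>\<^sup>+\<eta>\<in>{0<..}. ennreal (exp (- I * (\<eta> - h)\<^sup>2 / 2) * \<rho> \<eta>) \<partial>lborel)"

definition posterior_const :: "(real \<Rightarrow> real) \<Rightarrow> real \<Rightarrow> real \<Rightarrow> real" where
  "posterior_const \<rho> I h =
     (\<integral>x. prior_ext \<rho> (x / sqrt I + h) * exp (- x\<^sup>2 / 2) \<partial>lborel)"

definition posterior_normalized :: "(real \<Rightarrow> real) \<Rightarrow> real \<Rightarrow> real \<Rightarrow> real \<Rightarrow> real" where
  "posterior_normalized \<rho> I h x =
     inverse (posterior_const \<rho> I h) * (prior_ext \<rho> (x / sqrt I + h) * exp (- x\<^sup>2 / 2))"

end

theory Submission
  imports Defs "HOL-Real_Asymp.Real_Asymp"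
begin

text \<open>
  The proof has a probabilistic half, which only serves to show that the estimator \<open>\<theta>h\<close> converges
  to \<open>\<theta>0\<close> almost surely, and an analytic half, which works along a single trajectory of \<open>\<theta>h\<close>.

  For a geometric Brownian motion \<open>u\<close> the integral of \<open>1/u\<close> against \<open>u\<close> is explicit:
  by It\^o's formula \<open>J k = \<sigma> q k w k(T) - \<theta>0 \<mu> k T\<close>
  (\<open>fourier_mode_stochastic_logarithm\<close>). This is obtained here directly from the definition of the
  integral. Freezing \<open>1/u\<close> at the left end points of a uniform partition gives Riemann sums that
  converge to \<open>J k\<close>; each summand is \<open>exp D - 1\<close>, where \<open>D\<close> is an increment of \<open>ln u\<close>, and the difference
  between the sum and \<open>\<sigma> q k w k(T) - \<theta>0 \<mu> k T\<close> is a sum of pairwise independent remainders whose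
  second moment is computed from Gaussian moments and tends to 0. Consequently \<open>\<theta>h N - \<theta>0\<close> is \<open>- \<sigma>/T\<close>
  times \<open>(\<Sum>k\<le>N. a k X k) / (\<Sum>k\<le>N. (a k)\<^sup>2)\<close> with independent centred normal \<open>X k\<close> of variance \<open>T\<close> and
  \<open>a k = \<mu> k / q k\<close>. Well-posedness makes \<open>a k \<ge> 1\<close> eventually, and then the fourth moments of these
  normalized sums are summable, which yields the strong law \<open>weighted_normal_strong_law\<close>.

  For the analytic half, let \<open>h N \<longlonglongrightarrow> \<theta>0\<close> and \<open>I N \<longlonglongrightarrow> \<infinity>\<close>. At a fixed point \<open>x\<close> the rescaled prior
  \<open>\<rho> (h N + x / sqrt (I N))\<close> converges to \<open>\<rho> \<theta>0\<close>, and on the window \<open>\<bar>x\<bar> \<le> sqrt (I N) d\<close> it is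
  bounded, so dominated convergence applies there; outside the window a tail hypothesis is used
  (\<open>rescaled_density_local_limit\<close>). The lemma is applied twice. With the weight \<open>f\<close> the tail hypothesis is
  \<open>C2\<close>. With the constant weight 1 it says that the normalizing constants converge to
  \<open>\<rho> \<theta>0 sqrt (2 \<pi>)\<close>; the tail condition is then not an assumption of the theorem, but
  follows from the finiteness of the posterior denominator for \<open>N = 1\<close>, because the Gaussian factor for large \<open>N\<close> is
  negligible against the one for \<open>N = 1\<close> away from \<open>\<theta>0\<close> (\<open>gaussian_tail_of_integrable_density\<close>).
  The two limits together give the claim.
\<close>

section \<open>Stochastic integrals as limits of Riemann sums\<close>

text \<open>The sets \<open>A n\<close> may fail to be measurable, as happens for events that quantify over a continuum of times.
  The statement survives because the measure of a non-measurable set is 0 by convention.\<close>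

lemma (in prob_space) eventually_not_in_imp_prob_tendsto_0:
  assumes "AE \<omega> in M. \<forall>\<^sub>F n in sequentially. \<omega> \<notin> A n"
  shows "(\<lambda>n. prob (A n)) \<longlonglongrightarrow> 0"
proof -
  \<comment> \<open>The indicator functions of the measurable version tend to 0 almost surely and are dominated by 1.\<close>
  define B where "B n = (if A n \<in> events then A n else {})" for n
  have [measurable]: "B n \<in> events" for n by (simp add: B_def)
  have "(\<lambda>n. \<integral>\<omega>. indicator (B n) \<omega> \<partial>M) \<longlonglongrightarrow> (\<integral>\<omega>. 0 \<partial>M :: real)"
  proof (rule integral_dominated_convergence[where w = "\<lambda>_. 1"])
    show "AE \<omega> in M. (\<lambda>n. indicator (B n) \<omega> :: real) \<longlonglongrightarrow> 0"
      using assms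
    proof eventually_elim
      case (elim \<omega>)
      show ?case
        by (rule tendsto_eventually, rule eventually_mono[OF elim]) (auto simp: B_def)
    qed
  qed auto
  moreover have "(\<integral>\<omega>. indicator (B n) \<omega> \<partial>M) = prob (A n)" for n
    by (auto simp: B_def measure_notin_sets)
  ultimately show ?thesis by simp
qed

lemma uniform_partition_cell:
  fixes t T :: real
  assumes "0 < t" "t \<le> T"
  obtains i where "i < Suc n" "real i * T / Suc n < t" "t \<le> real (Suc i) * T / Suc n"
proof -
  define i where "i = nat (\<lceil>t * Suc n / T\<rceil> - 1)"
  have T: "T > 0" using assms by simp
  have "t * Suc n / T > 0" using assms T by simp
  then have c: "\<lceil>t * Suc n / T\<rceil> \<ge> 1" by linarith
  have "t * Suc n \<le> T * Suc n" using assms by (intro mult_right_mono) auto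
  then have "t * Suc n / T \<le> Suc n" using T by (simp add: divide_le_eq mult.commute)
  then have "\<lceil>t * Suc n / T\<rceil> \<le> Suc n" by linarith
  then have 1: "i < Suc n" using c unfolding i_def by linarith
  have "real i = of_int \<lceil>t * Suc n / T\<rceil> - 1" using c unfolding i_def by simp
  then have "real i < t * Suc n / T" "t * Suc n / T \<le> real (Suc i)" by linarith+
  then have "real i * T / Suc n < t" "t \<le> real (Suc i) * T / Suc n"
    using T by (simp_all add: field_simps)
  with 1 that show thesis by blast
qed

lemma step_approximation_on_cell:
  fixes g :: "real \<Rightarrow> real"
  assumes T: "0 < T" and i: "i < Suc n"
    and t: "real i * T / Suc n < t" "t \<le> real (Suc i) * T / Suc n"
  shows "(\<Sum>j<Suc n. g (real j * T / Suc n) *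
            indicator {real j * T / Suc n<..real (Suc j) * T / Suc n} t) = g (real i * T / Suc n)"
proof -
  have mono: "real j * T / Suc n \<le> real k * T / Suc n" if "j \<le> k" for j k
    using that T by (intro divide_right_mono mult_right_mono) auto
  have "indicator {real j * T / Suc n<..real (Suc j) * T / Suc n} t = (if j = i then 1 else 0 :: real)" for j
  proof -
    consider "j < i" | "j = i" | "j > i" by linarith
    then show ?thesis
    proof cases
      case 1
      then show ?thesis using mono[of "Suc j" i] t by (auto simp: indicator_def)
    next
      case 3
      then show ?thesis using mono[of "Suc i" j] t by (auto simp: indicator_def)
    qed (use t in auto)
  qed
  then have "(\<Sum>j<Suc n. g (real j * T / Suc n) *
      indicator {real j * T / Suc n<..real (Suc j) * T / Suc n} t) =
    (\<Sum>j<Suc n. if j = i then g (real i * T / Suc n) else 0)"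
    by (intro sum.cong) auto
  also have "\<dots> = g (real i * T / Suc n)"
    using i by (subst sum.delta) auto
  finally show ?thesis .
qed

lemma step_approximation_uniform:
  fixes g :: "real \<Rightarrow> real"
  assumes T: "0 < T" and cont: "continuous_on {0..T} g" and e: "e > 0"
  shows "\<forall>\<^sub>F n in sequentially. \<forall>t\<in>{0<..T}.
    \<bar>(\<Sum>j<Suc n. g (real j * T / Suc n) *
       indicator {real j * T / Suc n<..real (Suc j) * T / Suc n} t) - g t\<bar> < e"
proof -
  have "uniformly_continuous_on {0..T} g"
    by (rule compact_uniformly_continuous[OF cont]) simp
  then obtain d where d: "d > 0"
    "\<And>s t. s \<in> {0..T} \<Longrightarrow> t \<in> {0..T} \<Longrightarrow> dist s t < d \<Longrightarrow> dist (g s) (g t) < e"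
    using e unfolding uniformly_continuous_on_def by metis
  have "(\<lambda>n. T / Suc n) \<longlonglongrightarrow> 0"
    using LIMSEQ_Suc[OF lim_const_over_n[of T]] by simp
  then have "\<forall>\<^sub>F n in sequentially. T / Suc n < d"
    using d(1) by (rule order_tendstoD)
  then show ?thesis
  proof eventually_elim
    case (elim n)
    show ?case
    proof
      fix t assume t: "t \<in> {0<..T}"
      \<comment> \<open>The cell containing \<open>t\<close> is open on the left and closed on the right.\<close>
      then obtain i where i: "i < Suc n" "real i * T / Suc n < t" "t \<le> real (Suc i) * T / Suc n"
        using uniform_partition_cell[of t T n] by auto
      have "real (Suc i) * T / Suc n = real i * T / Suc n + T / Suc n"
        by (simp only: of_nat_Suc distrib_right add_divide_distrib mult_1_left)
      then have "dist (real i * T / Suc n) t < d"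
        using i elim unfolding dist_real_def by linarith
      moreover have "0 \<le> real i * T / Suc n" using T by simp
      ultimately have "dist (g (real i * T / Suc n)) (g t) < e"
        using i t by (intro d(2)) auto
      then show "\<bar>(\<Sum>j<Suc n. g (real j * T / Suc n) *
         indicator {real j * T / Suc n<..real (Suc j) * T / Suc n} t) - g t\<bar> < e"
        unfolding step_approximation_on_cell[OF T i] by (simp add: dist_real_def)
    qed
  qed
qed

text \<open>The only approximating sequence ever needed: the integrand frozen at the left end points of the
  uniform partition into \<open>n + 1\<close> cells. It converges uniformly along every continuous path.\<close>

lemma stochastic_integral_riemann_sums:
  assumes "prob_space M" and T: "0 < T" and int: "has_stochastic_integral M F T H X J"
  shows "tendsto_in_prob M
    (\<lambda>n \<omega>. \<Sum>i<Suc n. H (real i * T / Suc n) \<omega> *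
       (X (real (Suc i) * T / Suc n) \<omega> - X (real i * T / Suc n) \<omega>)) J"
proof -
  interpret prob_space M by fact
  define \<tau> where "\<tau> n i = real i * T / Suc n" for n i
  define \<xi> where "\<xi> n i = H (\<tau> n i)" for n i
  have simple: "simple_predictable F T (Suc n) (\<tau> n) (\<xi> n)" for n
  proof -
    have "\<tau> n i \<in> {0..T}" if "i < Suc n" for i
    proof -
      have "real i * T \<le> real (Suc n) * T" using that T by (intro mult_right_mono) auto
      then show ?thesis using T by (simp add: \<tau>_def divide_le_eq mult.commute)
    qed
    moreover have "\<forall>t\<in>{0..T}. H t \<in> borel_measurable (F t)"
      using int unfolding has_stochastic_integral_def by blast
    ultimately have "\<forall>i<Suc n. \<xi> n i \<in> borel_measurable (F (\<tau> n i))"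
      unfolding \<xi>_def by blast
    moreover have "\<tau> n i \<le> \<tau> n (Suc i)" for i
      unfolding \<tau>_def using T by (intro divide_right_mono mult_right_mono) auto
    moreover have "\<tau> n 0 = 0" "\<tau> n (Suc n) = T" by (simp_all add: \<tau>_def)
    ultimately show ?thesis unfolding simple_predictable_def by blast
  qed
  have unif: "(\<lambda>n. measure M {\<omega> \<in> space M. \<exists>t\<in>{0<..T}.
             \<bar>simple_process (Suc n) (\<tau> n) (\<xi> n) t \<omega> - H t \<omega>\<bar> > \<epsilon>}) \<longlonglongrightarrow> 0" if "\<epsilon> > 0" for \<epsilon>
  proof (rule eventually_not_in_imp_prob_tendsto_0)
    have "AE \<omega> in M. continuous_on {0..T} (\<lambda>t. H t \<omega>)"
      using int unfolding has_stochastic_integral_def by blast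
    then show "AE \<omega> in M. \<forall>\<^sub>F n in sequentially. \<omega> \<notin> {\<omega> \<in> space M. \<exists>t\<in>{0<..T}.
             \<bar>simple_process (Suc n) (\<tau> n) (\<xi> n) t \<omega> - H t \<omega>\<bar> > \<epsilon>}"
    proof eventually_elim
      case (elim \<omega>)
      show ?case
        using step_approximation_uniform[OF T elim that]
        by eventually_elim (auto simp: simple_process_def \<xi>_def \<tau>_def not_less dest!: bspec)
    qed
  qed
  have "tendsto_in_prob M (\<lambda>n. simple_integral (Suc n) (\<tau> n) (\<xi> n) X) J"
    using int simple unif unfolding has_stochastic_integral_def by blast
  then show ?thesis unfolding simple_integral_def[abs_def] \<xi>_def \<tau>_def .
qed

section \<open>Limits in probability\<close>

lemma tendsto_in_prob_unique:
  assumes "prob_space M"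
    and [measurable]: "\<And>n. Y n \<in> borel_measurable M" "Z \<in> borel_measurable M" "Z' \<in> borel_measurable M"
    and Z: "tendsto_in_prob M Y Z" and Z': "tendsto_in_prob M Y Z'"
  shows "AE \<omega> in M. Z \<omega> = Z' \<omega>"
proof -
  interpret prob_space M by fact
  have "prob {\<omega> \<in> space M. \<bar>Z \<omega> - Z' \<omega>\<bar> > e} = 0" if e: "e > 0" for e
  proof -
    have "prob {\<omega> \<in> space M. \<bar>Z \<omega> - Z' \<omega>\<bar> > e} \<le>
      prob {\<omega> \<in> space M. \<bar>Y n \<omega> - Z \<omega>\<bar> > e/2} + prob {\<omega> \<in> space M. \<bar>Y n \<omega> - Z' \<omega>\<bar> > e/2}" for n
    proof (rule order.trans[OF finite_measure_mono measure_Un_le])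
      show "{\<omega> \<in> space M. \<bar>Z \<omega> - Z' \<omega>\<bar> > e} \<subseteq>
        {\<omega> \<in> space M. \<bar>Y n \<omega> - Z \<omega>\<bar> > e/2} \<union> {\<omega> \<in> space M. \<bar>Y n \<omega> - Z' \<omega>\<bar> > e/2}"
        by (intro subsetI, clarsimp) argo
    qed measurable
    moreover have "(\<lambda>n. prob {\<omega> \<in> space M. \<bar>Y n \<omega> - Z \<omega>\<bar> > e/2} +
        prob {\<omega> \<in> space M. \<bar>Y n \<omega> - Z' \<omega>\<bar> > e/2}) \<longlonglongrightarrow> 0 + 0"
      using Z Z' half_gt_zero[OF e] unfolding tendsto_in_prob_def by (intro tendsto_add) blast+
    ultimately have "prob {\<omega> \<in> space M. \<bar>Z \<omega> - Z' \<omega>\<bar> > e} \<le> 0"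
      by (intro LIMSEQ_le_const) auto
    then show ?thesis by (simp add: measure_le_0_iff)
  qed
  then have "AE \<omega> in M. \<not> (\<bar>Z \<omega> - Z' \<omega>\<bar> > inverse (Suc n))" for n
    by (subst AE_iff_measurable[OF _ refl]) (auto simp: emeasure_eq_measure)
  then have "AE \<omega> in M. \<forall>n. \<not> (\<bar>Z \<omega> - Z' \<omega>\<bar> > inverse (Suc n))"
    by (simp add: AE_all_countable)
  then show ?thesis
  proof eventually_elim
    case (elim \<omega>)
    show ?case
    proof (rule ccontr)
      assume "Z \<omega> \<noteq> Z' \<omega>"
      then obtain n where "inverse (Suc n) < \<bar>Z \<omega> - Z' \<omega>\<bar>"
        using reals_Archimedean[of "\<bar>Z \<omega> - Z' \<omega>\<bar>"] by auto
      with elim show False by blast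
    qed
  qed
qed

lemma tendsto_in_prob_cong_AE:
  assumes "prob_space M" and [measurable]: "\<And>n. Y n \<in> borel_measurable M" "\<And>n. Y' n \<in> borel_measurable M"
      "Z \<in> borel_measurable M"
    and eq: "\<And>n. AE \<omega> in M. Y n \<omega> = Y' n \<omega>" and Y: "tendsto_in_prob M Y Z"
  shows "tendsto_in_prob M Y' Z"
proof -
  interpret prob_space M by fact
  have "prob {\<omega> \<in> space M. \<bar>Y' n \<omega> - Z \<omega>\<bar> > e} = prob {\<omega> \<in> space M. \<bar>Y n \<omega> - Z \<omega>\<bar> > e}" for n e
    by (rule finite_measure_eq_AE) (use eq[of n] in \<open>auto\<close>)
  then show ?thesis using Y by (simp add: tendsto_in_prob_def)
qed

lemma tendsto_in_prob_of_second_moment: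
  assumes "prob_space M"
    and int: "\<And>n. integrable M (\<lambda>\<omega>. (Y n \<omega> - Z \<omega>)\<^sup>2)"
    and lim: "(\<lambda>n. \<integral>\<omega>. (Y n \<omega> - Z \<omega>)\<^sup>2 \<partial>M) \<longlonglongrightarrow> 0"
  shows "tendsto_in_prob M Y Z"
  unfolding tendsto_in_prob_def
proof (intro allI impI)
  interpret prob_space M by fact
  fix e :: real assume e: "e > 0"
  have "prob {\<omega> \<in> space M. \<bar>Y n \<omega> - Z \<omega>\<bar> > e} \<le> (\<integral>\<omega>. (Y n \<omega> - Z \<omega>)\<^sup>2 \<partial>M) / e\<^sup>2" for n
  proof -
    have [measurable]: "(\<lambda>\<omega>. (Y n \<omega> - Z \<omega>)\<^sup>2) \<in> borel_measurable M" using int[of n] by simp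
    have "prob {\<omega> \<in> space M. \<bar>Y n \<omega> - Z \<omega>\<bar> > e} \<le> prob {\<omega> \<in> space M. (Y n \<omega> - Z \<omega>)\<^sup>2 \<ge> e\<^sup>2}"
    proof (rule finite_measure_mono)
      have "e\<^sup>2 \<le> (Y n \<omega> - Z \<omega>)\<^sup>2" if "\<bar>Y n \<omega> - Z \<omega>\<bar> > e" for \<omega>
        using that e abs_le_square_iff[of e "Y n \<omega> - Z \<omega>"] by auto
      then show "{\<omega> \<in> space M. \<bar>Y n \<omega> - Z \<omega>\<bar> > e} \<subseteq> {\<omega> \<in> space M. (Y n \<omega> - Z \<omega>)\<^sup>2 \<ge> e\<^sup>2}"
        by auto
    qed measurable
    also have "\<dots> \<le> (\<integral>\<omega>. (Y n \<omega> - Z \<omega>)\<^sup>2 \<partial>M) / e\<^sup>2"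
      using e by (intro integral_Markov_inequality_measure[OF int sets.empty_sets]) auto
    finally show ?thesis .
  qed
  moreover have "(\<lambda>n. (\<integral>\<omega>. (Y n \<omega> - Z \<omega>)\<^sup>2 \<partial>M) / e\<^sup>2) \<longlonglongrightarrow> 0"
    using tendsto_divide_zero[OF lim] .
  ultimately show "(\<lambda>n. prob {\<omega> \<in> space M. \<bar>Y n \<omega> - Z \<omega>\<bar> > e}) \<longlonglongrightarrow> 0"
    by (rule tendsto_sandwich[OF always_eventually[OF allI[OF measure_nonneg]] always_eventually[OF allI] tendsto_const])
qed

text \<open>Pairwise independence suffices since a second moment only involves products of two terms. For Brownian
  increments it is read off from the independence of each increment from the past.\<close>

lemma (in prob_space) second_moment_sum_pairwise_indep:
  fixes R :: "nat \<Rightarrow> 'a \<Rightarrow> real"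
  assumes ind: "\<And>i j. i < j \<Longrightarrow> j < n \<Longrightarrow> indep_var borel (R i) borel (R j)"
    and int: "\<And>i. i < n \<Longrightarrow> integrable M (R i)" and int2: "\<And>i. i < n \<Longrightarrow> integrable M (\<lambda>\<omega>. (R i \<omega>)\<^sup>2)"
    and m: "\<And>i. i < n \<Longrightarrow> expectation (R i) = m" and v: "\<And>i. i < n \<Longrightarrow> expectation (\<lambda>\<omega>. (R i \<omega>)\<^sup>2) = v"
  shows "integrable M (\<lambda>\<omega>. (\<Sum>i<n. R i \<omega>)\<^sup>2)"
    and "expectation (\<lambda>\<omega>. (\<Sum>i<n. R i \<omega>)\<^sup>2) \<le> real n * v + (real n * m)\<^sup>2"
proof -
  have prod_int: "integrable M (\<lambda>\<omega>. R i \<omega> * R j \<omega>)"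
    and prod: "expectation (\<lambda>\<omega>. R i \<omega> * R j \<omega>) = (if i = j then v else m\<^sup>2)"
    if ij: "i < n" "j < n" for i j
  proof -
    consider "i < j" | "i = j" | "j < i" by linarith
    then have "integrable M (\<lambda>\<omega>. R i \<omega> * R j \<omega>) \<and>
      expectation (\<lambda>\<omega>. R i \<omega> * R j \<omega>) = (if i = j then v else m\<^sup>2)"
    proof cases
      case 1
      then show ?thesis
        using indep_var_integrable[OF ind int int, of i j]
          indep_var_lebesgue_integral[OF ind int int, of i j] ij m
        by (simp add: power2_eq_square)
    next
      case 2
      then show ?thesis using ij int2 v by (simp add: power2_eq_square)
    next
      case 3
      then show ?thesis
        using indep_var_integrable[OF ind int int, of j i]
          indep_var_lebesgue_integral[OF ind int int, of j i] ij m
        by (simp add: power2_eq_square mult.commute)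
    qed
    then show "integrable M (\<lambda>\<omega>. R i \<omega> * R j \<omega>)"
      "expectation (\<lambda>\<omega>. R i \<omega> * R j \<omega>) = (if i = j then v else m\<^sup>2)" by auto
  qed
  have sq: "(\<Sum>i<n. R i \<omega>)\<^sup>2 = (\<Sum>i<n. \<Sum>j<n. R i \<omega> * R j \<omega>)" for \<omega>
    by (simp add: power2_eq_square sum_product)
  show "integrable M (\<lambda>\<omega>. (\<Sum>i<n. R i \<omega>)\<^sup>2)"
    unfolding sq using prod_int by (intro Bochner_Integration.integrable_sum) auto
  have "expectation (\<lambda>\<omega>. (\<Sum>i<n. R i \<omega>)\<^sup>2) = (\<Sum>i<n. \<Sum>j<n. if i = j then v else m\<^sup>2)"
  proof -
    have "expectation (\<lambda>\<omega>. (\<Sum>i<n. R i \<omega>)\<^sup>2) = (\<Sum>i<n. expectation (\<lambda>\<omega>. \<Sum>j<n. R i \<omega> * R j \<omega>))"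
      unfolding sq using prod_int by (intro Bochner_Integration.integral_sum Bochner_Integration.integrable_sum) auto
    also have "\<dots> = (\<Sum>i<n. \<Sum>j<n. expectation (\<lambda>\<omega>. R i \<omega> * R j \<omega>))"
      using prod_int by (intro sum.cong refl Bochner_Integration.integral_sum) auto
    also have "\<dots> = (\<Sum>i<n. \<Sum>j<n. if i = j then v else m\<^sup>2)"
      using prod by (intro sum.cong refl) auto
    finally show ?thesis .
  qed
  also have "\<dots> \<le> (\<Sum>i<n. \<Sum>j<n. (if i = j then v else 0) + m\<^sup>2)"
    by (intro sum_mono) auto
  also have "\<dots> = real n * v + (real n * m)\<^sup>2"
    by (simp add: sum.distrib power2_eq_square distrib_left mult.assoc mult.left_commute)
  finally show "expectation (\<lambda>\<omega>. (\<Sum>i<n. R i \<omega>)\<^sup>2) \<le> real n * v + (real n * m)\<^sup>2" .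
qed

section \<open>Gaussian moments\<close>

lemma has_bochner_integral_distributed:
  fixes g :: "real \<Rightarrow> real"
  assumes "distributed M lborel X (\<lambda>x. ennreal (p x))" "\<And>x. 0 \<le> p x" "g \<in> borel_measurable borel"
    and "has_bochner_integral lborel (\<lambda>x. p x * g x) c"
  shows "has_bochner_integral M (\<lambda>\<omega>. g (X \<omega>)) c"
  using assms distributed_integrable[of M lborel X p g] distributed_integral[of M lborel X p g]
  by (simp add: has_bochner_integral_iff)

text \<open>Completing the square: an exponential factor shifts the mean of a centred normal density by
  \<open>c s\<^sup>2\<close>. All exponential moments below are ordinary moments of the shifted density.\<close>

lemma normal_density_exponential_tilt:
  assumes "0 < s"
  shows "normal_density 0 s x * exp (c * x) = exp (c\<^sup>2 * s\<^sup>2 / 2) * normal_density (c * s\<^sup>2) s x"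
proof -
  have "- x\<^sup>2 / (2 * s\<^sup>2) + c * x = c\<^sup>2 * s\<^sup>2 / 2 + - (x - c * s\<^sup>2)\<^sup>2 / (2 * s\<^sup>2)"
    using assms by (simp add: field_simps power2_eq_square)
  then show ?thesis
    by (simp add: normal_density_def exp_add[symmetric])
qed

lemma normal_moments:
  assumes X: "distributed M lborel X (\<lambda>x. ennreal (normal_density 0 s x))" and s: "0 < s"
  shows "has_bochner_integral M (\<lambda>\<omega>. exp (c * X \<omega>)) (exp (c\<^sup>2 * s\<^sup>2 / 2))"
    and "has_bochner_integral M (\<lambda>\<omega>. X \<omega> * exp (c * X \<omega>)) (c * s\<^sup>2 * exp (c\<^sup>2 * s\<^sup>2 / 2))"
    and "has_bochner_integral M X 0"
    and "has_bochner_integral M (\<lambda>\<omega>. (X \<omega>)\<^sup>2) (s\<^sup>2)"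
    and "has_bochner_integral M (\<lambda>\<omega>. (X \<omega>) ^ 4) (3 * s ^ 4)"
proof -
  note I = has_bochner_integral_distributed[OF X normal_density_nonneg]
  have "has_bochner_integral lborel (normal_density (c * s\<^sup>2) s) 1"
    using s by (simp add: has_bochner_integral_iff)
  from has_bochner_integral_mult_right[OF this, of "exp (c\<^sup>2 * s\<^sup>2 / 2)"]
  show "has_bochner_integral M (\<lambda>\<omega>. exp (c * X \<omega>)) (exp (c\<^sup>2 * s\<^sup>2 / 2))"
    by (intro I) (simp_all add: normal_density_exponential_tilt[OF s])
  have "has_bochner_integral lborel (\<lambda>x. normal_density (c * s\<^sup>2) s x * x) (c * s\<^sup>2)"
    using normal_moment_nz_1[OF s] .
  from has_bochner_integral_mult_right[OF this, of "exp (c\<^sup>2 * s\<^sup>2 / 2)"]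
  show "has_bochner_integral M (\<lambda>\<omega>. X \<omega> * exp (c * X \<omega>)) (c * s\<^sup>2 * exp (c\<^sup>2 * s\<^sup>2 / 2))"
  proof (intro I[where g = "\<lambda>x. x * exp (c * x)"])
    have "normal_density 0 s x * (x * exp (c * x)) = exp (c\<^sup>2 * s\<^sup>2 / 2) * (normal_density (c * s\<^sup>2) s x * x)" for x
      using normal_density_exponential_tilt[OF s, of x c] by (metis mult.assoc mult.commute)
    moreover assume "has_bochner_integral lborel
      (\<lambda>x. exp (c\<^sup>2 * s\<^sup>2 / 2) * (normal_density (c * s\<^sup>2) s x * x)) (exp (c\<^sup>2 * s\<^sup>2 / 2) * (c * s\<^sup>2))"
    ultimately show "has_bochner_integral lborel (\<lambda>x. normal_density 0 s x * (x * exp (c * x)))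
      (c * s\<^sup>2 * exp (c\<^sup>2 * s\<^sup>2 / 2))"
      by (simp only: mult.commute[of "exp (c\<^sup>2 * s\<^sup>2 / 2)" "c * s\<^sup>2"])
  qed simp
  show "has_bochner_integral M X 0"
    by (rule I[where g = "\<lambda>x. x"]) (use normal_moment_nz_1[OF s, of 0] in auto)
  show "has_bochner_integral M (\<lambda>\<omega>. (X \<omega>)\<^sup>2) (s\<^sup>2)"
    by (rule I[where g = "\<lambda>x. x\<^sup>2"]) (use normal_moment_even[OF s, of 0 1] in simp_all)
  have "fact 4 / ((2 / s\<^sup>2)\<^sup>2 * fact 2) = 3 * s ^ 4"
    using s by (simp add: fact_numeral field_simps power2_eq_square eval_nat_numeral)
  then show "has_bochner_integral M (\<lambda>\<omega>. (X \<omega>) ^ 4) (3 * s ^ 4)"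
    by (intro I[where g = "\<lambda>x. x ^ 4"]) (use normal_moment_even[OF s, of 0 2] in simp_all)
qed

section \<open>The stochastic logarithm of a Fourier mode\<close>

text \<open>For \<open>u\<close> solving \<open>du = - a u dt + s u dW\<close>, the relative increment of \<open>u\<close> over a time step \<open>h\<close> on
  which \<open>W\<close> grows by \<open>x\<close> is \<open>exp (- (a + s\<^sup>2 / 2) h + s x) - 1\<close>. The remainder is its deviation from the
  Euler step \<open>s x - a h\<close>.\<close>

definition exp_remainder :: "real \<Rightarrow> real \<Rightarrow> real \<Rightarrow> real \<Rightarrow> real" where
  "exp_remainder a s h x = exp (- (a + s\<^sup>2 / 2) * h + s * x) - 1 - (s * x - a * h)"

lemma exp_remainder_measurable [measurable]: "exp_remainder a s h \<in> borel_measurable borel"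
  unfolding exp_remainder_def[abs_def] by measurable

text \<open>Both moments are kept in closed form; the cancellation that makes them of smaller order than \<open>h\<close> takes place in
  \<open>exp_remainder_total_moment_limits\<close>.\<close>

lemma exp_remainder_moments:
  assumes "prob_space M" and X: "distributed M lborel X (\<lambda>x. ennreal (normal_density 0 (sqrt h) x))"
    and h: "0 < h"
  shows "has_bochner_integral M (\<lambda>\<omega>. exp_remainder a s h (X \<omega>)) (exp (- a * h) - 1 + a * h)"
    and "has_bochner_integral M (\<lambda>\<omega>. (exp_remainder a s h (X \<omega>))\<^sup>2)
      (exp ((s\<^sup>2 - 2 * a) * h) + s\<^sup>2 * h + (1 - a * h)\<^sup>2 - 2 * (s\<^sup>2 * h + 1 - a * h) * exp (- a * h))"
proof -
  interpret prob_space M by fact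
  have one: "has_bochner_integral M (\<lambda>_. c) c" for c :: real
    by (simp add: has_bochner_integral_iff prob_space)
  define b where "b = - (a + s\<^sup>2 / 2) * h"
  have sq: "(sqrt h)\<^sup>2 = h" using h by simp
  note E = normal_moments[OF X, unfolded sq]
  have hh: "0 < sqrt h" using h by simp
  have 1: "exp b * exp (s\<^sup>2 * h / 2) = exp (- a * h)"
    by (simp add: b_def exp_add[symmetric] algebra_simps)
  have 2: "(exp b)\<^sup>2 * exp ((2 * s)\<^sup>2 * h / 2) = exp ((s\<^sup>2 - 2 * a) * h)"
    by (simp add: b_def exp_add[symmetric] exp_double[symmetric] algebra_simps power2_eq_square)
  have R: "exp_remainder a s h x = exp b * exp (s * x) + (- s) * x + (- (1 - a * h))" for x
    by (simp add: exp_remainder_def b_def exp_add)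
  have "has_bochner_integral M (\<lambda>\<omega>. exp_remainder a s h (X \<omega>))
      (exp b * exp (s\<^sup>2 * h / 2) + (- s) * 0 + (- (1 - a * h)))"
    unfolding R by (intro has_bochner_integral_add has_bochner_integral_mult_right E hh one)
  then show "has_bochner_integral M (\<lambda>\<omega>. exp_remainder a s h (X \<omega>)) (exp (- a * h) - 1 + a * h)"
    unfolding 1 by (simp add: algebra_simps)
  have R2: "(exp_remainder a s h x)\<^sup>2 = (exp b)\<^sup>2 * exp (2 * s * x) + s\<^sup>2 * x\<^sup>2 + (1 - a * h)\<^sup>2
      + (- 2 * s * exp b) * (x * exp (s * x)) + (- 2 * (1 - a * h) * exp b) * exp (s * x)
      + (2 * (1 - a * h) * s) * x" for x
  proof -
    have "exp (2 * s * x) = (exp (s * x))\<^sup>2" by (simp add: exp_double[symmetric] mult.assoc)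
    then show ?thesis unfolding R by (simp add: power2_eq_square algebra_simps)
  qed
  have "has_bochner_integral M (\<lambda>\<omega>. (exp_remainder a s h (X \<omega>))\<^sup>2)
    ((exp b)\<^sup>2 * exp ((2 * s)\<^sup>2 * h / 2) + s\<^sup>2 * h + (1 - a * h)\<^sup>2
      + (- 2 * s * exp b) * (s * h * exp (s\<^sup>2 * h / 2)) + (- 2 * (1 - a * h) * exp b) * exp (s\<^sup>2 * h / 2)
      + (2 * (1 - a * h) * s) * 0)"
    unfolding R2 by (intro has_bochner_integral_add has_bochner_integral_mult_right E hh one)
  also have "(- 2 * s * exp b) * (s * h * exp (s\<^sup>2 * h / 2)) = - 2 * s\<^sup>2 * h * exp (- a * h)"
    unfolding 1[symmetric] by (simp add: power2_eq_square)
  also have "(- 2 * (1 - a * h) * exp b) * exp (s\<^sup>2 * h / 2) = - 2 * (1 - a * h) * exp (- a * h)"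
    unfolding 1[symmetric] by simp
  finally show "has_bochner_integral M (\<lambda>\<omega>. (exp_remainder a s h (X \<omega>))\<^sup>2)
      (exp ((s\<^sup>2 - 2 * a) * h) + s\<^sup>2 * h + (1 - a * h)\<^sup>2 - 2 * (s\<^sup>2 * h + 1 - a * h) * exp (- a * h))"
    unfolding 2 by (simp add: algebra_simps)
qed

lemma exp_rate_limit: "(\<lambda>n. real (Suc n) * (exp (c / Suc n) - 1)) \<longlonglongrightarrow> c"
proof -
  have "((\<lambda>h. (exp (c * h) - 1) / h) \<longlongrightarrow> c) (at 0)"
  proof -
    have "((\<lambda>h. exp (c * h)) has_real_derivative c) (at 0)"
      by (auto intro!: derivative_eq_intros)
    from DERIV_D[OF this] show ?thesis by simp
  qed
  moreover have "filterlim (\<lambda>n. inverse (real (Suc n))) (at 0) sequentially"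
    unfolding filterlim_at using LIMSEQ_inverse_real_of_nat by auto
  ultimately have "(\<lambda>n. (exp (c * inverse (real (Suc n))) - 1) / inverse (real (Suc n))) \<longlonglongrightarrow> c"
    by (rule filterlim_compose)
  then show ?thesis by (simp add: field_simps)
qed

text \<open>The expression bounds the second moment of a sum of \<open>n + 1\<close> pairwise independent remainders with time
  step \<open>T / (n + 1)\<close>. It vanishes in the limit because the first-order terms of the exponentials cancel: the
  It\^o correction \<open>s\<^sup>2 / 2\<close> in the drift is exactly what is needed for this.\<close>

lemma exp_remainder_total_moment_limits:
  fixes a s T :: real
  defines "m \<equiv> \<lambda>h. exp (- a * h) - 1 + a * h"
    and "v \<equiv> \<lambda>h. exp ((s\<^sup>2 - 2 * a) * h) + s\<^sup>2 * h + (1 - a * h)\<^sup>2 - 2 * (s\<^sup>2 * h + 1 - a * h) * exp (- a * h)"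
  shows "(\<lambda>n. real (Suc n) * v (T / Suc n) + (real (Suc n) * m (T / Suc n))\<^sup>2) \<longlonglongrightarrow> 0"
proof -
  have e: "(\<lambda>n. exp (- a * T / Suc n)) \<longlonglongrightarrow> exp 0"
    using LIMSEQ_Suc[OF lim_const_over_n[of "- a * T"]] by (intro tendsto_exp) simp
  have z: "(\<lambda>n. (a * T)\<^sup>2 / Suc n) \<longlonglongrightarrow> 0"
    using LIMSEQ_Suc[OF lim_const_over_n[of "(a * T)\<^sup>2"]] by simp
  have m: "real (Suc n) * m (T / Suc n) = real (Suc n) * (exp (- a * T / Suc n) - 1) + a * T" for n
    by (simp add: m_def field_simps)
  have v: "real (Suc n) * v (T / Suc n) =
      real (Suc n) * (exp ((s\<^sup>2 - 2 * a) * T / Suc n) - 1) + (s\<^sup>2 * T - 2 * a * T) + (a * T)\<^sup>2 / Suc n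
      - 2 * (s\<^sup>2 * T - a * T) * exp (- a * T / Suc n) - 2 * (real (Suc n) * (exp (- a * T / Suc n) - 1))" for n
  proof -
    define N where "N = real (Suc n)"
    define z where "z = T / N"
    have N: "N > 0" by (simp add: N_def)
    have T: "N * z = T" using N by (simp add: z_def)
    define x y where "x = exp ((s\<^sup>2 - 2 * a) * z)" and "y = exp (- a * z)"
    have sq: "(a * (N * z))\<^sup>2 / N = N * (a * z)\<^sup>2" using N by (simp add: power2_eq_square)
    have vz: "v z = x + s\<^sup>2 * z + (1 - a * z)\<^sup>2 - 2 * (s\<^sup>2 * z + 1 - a * z) * y"
      by (simp only: v_def x_def y_def)
    have "N * v z = N * (x - 1) + (s\<^sup>2 * (N * z) - 2 * a * (N * z)) + (a * (N * z))\<^sup>2 / N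
        - 2 * (s\<^sup>2 * (N * z) - a * (N * z)) * y - 2 * (N * (y - 1))"
      unfolding sq vz by (simp add: algebra_simps power2_eq_square)
    then show ?thesis unfolding T unfolding x_def y_def z_def N_def by simp
  qed
  have "(\<lambda>n. real (Suc n) * v (T / Suc n) + (real (Suc n) * m (T / Suc n))\<^sup>2) \<longlonglongrightarrow>
    ((s\<^sup>2 - 2 * a) * T + (s\<^sup>2 * T - 2 * a * T) + 0 - 2 * (s\<^sup>2 * T - a * T) * exp 0 - 2 * (- a * T))
     + (- a * T + a * T)\<^sup>2"
    unfolding m v
    by (intro tendsto_add[OF _ tendsto_power[OF tendsto_add[OF _ tendsto_const]]]
      tendsto_diff[OF tendsto_diff[OF tendsto_add[OF tendsto_add[OF _ tendsto_const] z]
        tendsto_mult[OF tendsto_const e]] tendsto_mult[OF tendsto_const]] exp_rate_limit)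
  then show ?thesis by (simp add: algebra_simps)
qed

lemma (in prob_space) indep_var_of_indep_set:
  assumes G: "subalgebra M G" and X: "X \<in> borel_measurable G" and Y: "Y \<in> borel_measurable M"
    and ind: "indep_set (sets G) (sets (vimage_algebra (space M) Y borel))"
  shows "indep_var borel X borel Y"
  unfolding indep_var_eq
proof (intro conjI)
  have sp: "space G = space M" using G by (simp add: subalgebra_def)
  show "random_variable borel X" using X G by (rule measurable_from_subalg[rotated])
  show "random_variable borel Y" by fact
  have 1: "sigma_sets (space M) {X -` A \<inter> space M | A. A \<in> sets borel} \<subseteq> sets G"
    unfolding sp[symmetric] using X by (intro sets.sigma_sets_subset) auto
  have 2: "sigma_sets (space M) {Y -` A \<inter> space M | A. A \<in> sets borel} = sets (vimage_algebra (space M) Y borel)"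
    by (simp add: sets_vimage_algebra)
  show "indep_set (sigma_sets (space M) {X -` A \<inter> space M | A. A \<in> sets borel})
     (sigma_sets (space M) {Y -` A \<inter> space M | A. A \<in> sets borel})"
    using ind 1 unfolding 2 indep_sets2_eq by blast
qed

text \<open>The initial value cancels in relative increments, so the terms of the Riemann sums are functions of the
  Brownian increment alone.\<close>

lemma fourier_mode_ratio:
  assumes "u0 \<omega> \<noteq> 0"
  shows "1 / fourier_mode \<sigma> \<mu> q \<theta> u0 W r \<omega> *
      (fourier_mode \<sigma> \<mu> q \<theta> u0 W t \<omega> - fourier_mode \<sigma> \<mu> q \<theta> u0 W r \<omega>) =
    exp_remainder (\<theta> * \<mu>) (\<sigma> * q) (t - r) (W t \<omega> - W r \<omega>)
      + (\<sigma> * q * (W t \<omega> - W r \<omega>) - \<theta> * \<mu> * (t - r))"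
proof -
  define b where "b = - (\<theta> * \<mu> + \<sigma>\<^sup>2 * q\<^sup>2 / 2)"
  have "1 / fourier_mode \<sigma> \<mu> q \<theta> u0 W r \<omega> *
      (fourier_mode \<sigma> \<mu> q \<theta> u0 W t \<omega> - fourier_mode \<sigma> \<mu> q \<theta> u0 W r \<omega>)
    = fourier_mode \<sigma> \<mu> q \<theta> u0 W t \<omega> / fourier_mode \<sigma> \<mu> q \<theta> u0 W r \<omega> - 1"
    using assms by (simp add: fourier_mode_def field_simps)
  also have "fourier_mode \<sigma> \<mu> q \<theta> u0 W t \<omega> / fourier_mode \<sigma> \<mu> q \<theta> u0 W r \<omega> =
    exp ((b * t + \<sigma> * q * W t \<omega>) - (b * r + \<sigma> * q * W r \<omega>))"
    using assms by (simp add: fourier_mode_def b_def exp_diff)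
  also have "(b * t + \<sigma> * q * W t \<omega>) - (b * r + \<sigma> * q * W r \<omega>) =
     - (\<theta> * \<mu> + (\<sigma> * q)\<^sup>2 / 2) * (t - r) + \<sigma> * q * (W t \<omega> - W r \<omega>)"
  proof -
    have "b = - (\<theta> * \<mu> + (\<sigma> * q)\<^sup>2 / 2)" by (simp add: b_def power_mult_distrib)
    then show ?thesis by (simp only:) (simp only: algebra_simps)
  qed
  finally show ?thesis by (simp add: exp_remainder_def)
qed

lemma brownian_motion_measurable:
  assumes "stochastic_basis M F" "brownian_motion M F W" "0 \<le> t"
  shows "W t \<in> borel_measurable M"
proof -
  have "subalgebra M (F t)" "W t \<in> borel_measurable (F t)"
    using assms by (auto simp: stochastic_basis_def brownian_motion_def)
  then show ?thesis by (rule measurable_from_subalg)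
qed

lemma brownian_increments_indep:
  assumes basis: "stochastic_basis M F" and W: "brownian_motion M F W"
    and t: "0 \<le> r" "r \<le> r'" "r' \<le> t" "t < t'"
  shows "prob_space.indep_var M borel (\<lambda>\<omega>. W r' \<omega> - W r \<omega>) borel (\<lambda>\<omega>. W t' \<omega> - W t \<omega>)"
proof -
  interpret prob_space M using basis by (simp add: stochastic_basis_def)
  interpret filtration "space M" "\<lambda>t. F (max 0 t)" using basis by (simp add: stochastic_basis_def)
  have mono: "W s \<in> borel_measurable (F t)" if "0 \<le> s" "s \<le> t" for s
  proof -
    have "sets (F (max 0 s)) \<subseteq> sets (F (max 0 t))" using that(2) by (rule sets_F_mono)
    moreover have "space (F (max 0 s)) = space (F (max 0 t))" by (simp add: space_F)
    moreover have "W s \<in> borel_measurable (F s)" using W that by (simp add: brownian_motion_def)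
    ultimately show ?thesis using that by (simp add: max_absorb2) (blast intro: measurable_mono[THEN subsetD, rotated -1])
  qed
  have "subalgebra M (F t)" using basis t by (simp add: stochastic_basis_def)
  then show ?thesis
  proof (rule indep_var_of_indep_set)
    show "(\<lambda>\<omega>. W r' \<omega> - W r \<omega>) \<in> borel_measurable (F t)"
      using t by (intro borel_measurable_diff mono) auto
    show "random_variable borel (\<lambda>\<omega>. W t' \<omega> - W t \<omega>)"
      using t by (intro borel_measurable_diff brownian_motion_measurable[OF basis W]) auto
    show "indep_set (sets (F t)) (sets (vimage_algebra (space M) (\<lambda>\<omega>. W t' \<omega> - W t \<omega>) borel))"
      using W t by (simp add: brownian_motion_def)
  qed
qed

text \<open>The variable \<open>Z\<close> is arbitrary, since only the remainder sums have to tend to 0; it will be the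
  telescoped sum of the Euler steps.\<close>

lemma exp_remainder_sums_vanish:
  fixes Z :: "'a \<Rightarrow> real"
  assumes basis: "stochastic_basis M F" and W: "brownian_motion M F W" and T: "0 < T"
  shows "tendsto_in_prob M (\<lambda>n \<omega>. (\<Sum>i<Suc n. exp_remainder a s (T / Suc n)
      (W (real (Suc i) * T / Suc n) \<omega> - W (real i * T / Suc n) \<omega>)) + Z \<omega>) Z"
proof -
  interpret prob_space M using basis by (simp add: stochastic_basis_def)
  define D where "D n i \<omega> = W (real (Suc i) * T / Suc n) \<omega> - W (real i * T / Suc n) \<omega>" for n i \<omega>
  define R where "R n i \<omega> = exp_remainder a s (T / Suc n) (D n i \<omega>)" for n i \<omega>
  have h: "T / Suc n > 0" for n using T by simp
  have step: "real (Suc i) * T / Suc n = real i * T / Suc n + T / Suc n" for i n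
    by (simp only: of_nat_Suc distrib_right add_divide_distrib mult_1_left)
  have nonneg: "0 \<le> real i * T / Suc n" for i n using T by simp
  have normal: "distributed M lborel (D n i) (\<lambda>x. ennreal (normal_density 0 (sqrt (T / Suc n)) x))" for n i
  proof -
    have "real i * T / Suc n < real (Suc i) * T / Suc n" using h[of n] unfolding step by simp
    then have "distributed M lborel (D n i) (\<lambda>x. ennreal (normal_density 0
        (sqrt (real (Suc i) * T / Suc n - real i * T / Suc n)) x))"
      using W nonneg[of i n] unfolding brownian_motion_def D_def[abs_def] by blast
    then show ?thesis unfolding step by simp
  qed
  note mom = exp_remainder_moments[OF prob_space_axioms normal h, of a s, folded R_def]
  have ind: "indep_var borel (R n i) borel (R n j)" if "i < j" for n i j
  proof -
    have "real (Suc i) * T / Suc n \<le> real j * T / Suc n"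
      using that T by (intro divide_right_mono mult_right_mono) auto
    moreover have "real i * T / Suc n \<le> real (Suc i) * T / Suc n"
      "real j * T / Suc n < real (Suc j) * T / Suc n" using h[of n] unfolding step by simp_all
    ultimately have "indep_var borel (D n i) borel (D n j)"
      unfolding D_def[abs_def] using brownian_increments_indep[OF basis W nonneg] by blast
    from indep_var_compose[OF this exp_remainder_measurable exp_remainder_measurable]
    show ?thesis unfolding R_def[abs_def] comp_def .
  qed
  have sm: "integrable M (\<lambda>\<omega>. (\<Sum>i<Suc n. R n i \<omega>)\<^sup>2)"
    "expectation (\<lambda>\<omega>. (\<Sum>i<Suc n. R n i \<omega>)\<^sup>2) \<le> real (Suc n) *
       (exp ((s\<^sup>2 - 2 * a) * (T / Suc n)) + s\<^sup>2 * (T / Suc n) + (1 - a * (T / Suc n))\<^sup>2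
         - 2 * (s\<^sup>2 * (T / Suc n) + 1 - a * (T / Suc n)) * exp (- a * (T / Suc n)))
       + (real (Suc n) * (exp (- a * (T / Suc n)) - 1 + a * (T / Suc n)))\<^sup>2" for n
    by (rule second_moment_sum_pairwise_indep[OF ind];
        use mom in \<open>force simp: has_bochner_integral_iff\<close>)+
  have "(\<lambda>n. expectation (\<lambda>\<omega>. (\<Sum>i<Suc n. R n i \<omega>)\<^sup>2)) \<longlonglongrightarrow> 0"
    by (rule tendsto_sandwich[OF always_eventually always_eventually tendsto_const
        exp_remainder_total_moment_limits[of s a T]])
       (use sm(2) in auto)
  then show ?thesis
    using sm(1) unfolding R_def D_def
    by (intro tendsto_in_prob_of_second_moment[OF prob_space_axioms]) (simp_all del: sum.lessThan_Suc of_nat_Suc)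
qed

text \<open>This is It\^o's formula \<open>du/u = d(ln u) + s\<^sup>2/2 dt\<close> for a geometric Brownian motion. The Riemann sums
  of the integral are a telescoping sum of Euler steps plus remainders that vanish in probability, and limits
  in probability are almost surely unique.\<close>

theorem fourier_mode_stochastic_logarithm:
  assumes basis: "stochastic_basis M F" and W: "brownian_motion M F W" and T: "0 < T"
    and u0: "u0 \<in> borel_measurable (F 0)" "AE \<omega> in M. u0 \<omega> \<noteq> 0"
    and J: "has_stochastic_integral M F T (\<lambda>t \<omega>. 1 / fourier_mode \<sigma> \<mu> q \<theta> u0 W t \<omega>)
              (fourier_mode \<sigma> \<mu> q \<theta> u0 W) J"
  shows "AE \<omega> in M. J \<omega> = \<sigma> * q * (W T \<omega> - W 0 \<omega>) - \<theta> * \<mu> * T"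
proof -
  interpret prob_space M using basis by (simp add: stochastic_basis_def)
  let ?u = "fourier_mode \<sigma> \<mu> q \<theta> u0 W"
  define \<tau> where "\<tau> n i = real i * T / Suc n" for n i
  define Z where "Z \<omega> = \<sigma> * q * (W T \<omega> - W 0 \<omega>) - \<theta> * \<mu> * T" for \<omega>
  define S where "S n \<omega> = (\<Sum>i<Suc n. 1 / ?u (\<tau> n i) \<omega> * (?u (\<tau> n (Suc i)) \<omega> - ?u (\<tau> n i) \<omega>))" for n \<omega>
  define E where "E n \<omega> = (\<Sum>i<Suc n. exp_remainder (\<theta> * \<mu>) (\<sigma> * q) (T / Suc n)
      (W (\<tau> n (Suc i)) \<omega> - W (\<tau> n i) \<omega>)) + Z \<omega>" for n \<omega>
  have nonneg: "0 \<le> \<tau> n i" for n i using T by (simp add: \<tau>_def)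
  have W_meas [measurable]: "W t \<in> borel_measurable M" if "0 \<le> t" for t
    using brownian_motion_measurable[OF basis W that] .
  have "subalgebra M (F 0)" using basis by (simp add: stochastic_basis_def)
  then have u0_meas: "u0 \<in> borel_measurable M" using u0(1) by (rule measurable_from_subalg)
  have u_meas: "?u t \<in> borel_measurable M" if "0 \<le> t" for t
    using W_meas[OF that] u0_meas unfolding fourier_mode_def by measurable
  have Z_meas: "Z \<in> borel_measurable M"
    using W_meas[of T] W_meas[of 0] T unfolding Z_def[abs_def] by simp
  have S_meas: "S n \<in> borel_measurable M" for n
    unfolding S_def[abs_def]
    by (intro borel_measurable_sum borel_measurable_times borel_measurable_divide borel_measurable_diff
        borel_measurable_const u_meas nonneg)
  have E_meas: "E n \<in> borel_measurable M" for n
    unfolding E_def[abs_def]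
    by (intro borel_measurable_sum borel_measurable_add Z_meas
        measurable_compose[OF _ exp_remainder_measurable] borel_measurable_diff W_meas nonneg)
  have "AE \<omega> in M. E n \<omega> = S n \<omega>" for n
    using u0(2)
  proof eventually_elim
    case (elim \<omega>)
    have step: "\<tau> n (Suc i) - \<tau> n i = T / Suc n" for i
      unfolding \<tau>_def by (simp only: of_nat_Suc distrib_right add_divide_distrib mult_1_left add_diff_cancel_left')
    have tel: "(\<Sum>i<Suc n. g (\<tau> n (Suc i)) - g (\<tau> n i)) = g T - g 0" for g :: "real \<Rightarrow> real"
      using sum_lessThan_telescope[of "\<lambda>i. g (\<tau> n i)" "Suc n"] by (simp add: \<tau>_def)
    have "S n \<omega> = (\<Sum>i<Suc n. exp_remainder (\<theta> * \<mu>) (\<sigma> * q) (T / Suc n)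
        (W (\<tau> n (Suc i)) \<omega> - W (\<tau> n i) \<omega>)) +
      (\<Sum>i<Suc n. \<sigma> * q * (W (\<tau> n (Suc i)) \<omega> - W (\<tau> n i) \<omega>) - \<theta> * \<mu> * (\<tau> n (Suc i) - \<tau> n i))"
      by (simp only: S_def fourier_mode_ratio[of u0 \<omega>, OF elim] step sum.distrib)
    also have "(\<Sum>i<Suc n. \<sigma> * q * (W (\<tau> n (Suc i)) \<omega> - W (\<tau> n i) \<omega>) - \<theta> * \<mu> * (\<tau> n (Suc i) - \<tau> n i))
      = Z \<omega>"
      unfolding sum_subtractf sum_distrib_left[symmetric] using tel[of "\<lambda>t. W t \<omega>"] tel[of "\<lambda>t. t"]
      by (simp add: Z_def sum_subtractf)
    finally show ?case by (simp add: E_def)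
  qed
  moreover have "tendsto_in_prob M E Z"
    unfolding E_def[abs_def] \<tau>_def by (rule exp_remainder_sums_vanish[OF basis W T])
  ultimately have "tendsto_in_prob M S Z"
    by (intro tendsto_in_prob_cong_AE[OF prob_space_axioms E_meas S_meas Z_meas])
  moreover have "tendsto_in_prob M S J"
    unfolding S_def[abs_def] \<tau>_def by (rule stochastic_integral_riemann_sums[OF prob_space_axioms T J])
  moreover have "J \<in> borel_measurable M" using J by (simp add: has_stochastic_integral_def)
  ultimately show ?thesis
    using tendsto_in_prob_unique[OF prob_space_axioms S_meas _ Z_meas, of J] by (simp add: Z_def)
qed

section \<open>Strong consistency of the estimator\<close>

lemma sum_squares_linear_growth:
  fixes a :: "nat \<Rightarrow> real"
  assumes "\<forall>\<^sub>F k in sequentially. 1 \<le> a k"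
  shows "\<forall>\<^sub>F N in sequentially. real N / 2 \<le> (\<Sum>k=1..N. (a k)\<^sup>2)"
proof -
  obtain K where K: "\<And>k. k \<ge> K \<Longrightarrow> 1 \<le> a k" using assms by (auto simp: eventually_sequentially)
  have "real N / 2 \<le> (\<Sum>k=1..N. (a k)\<^sup>2)" if N: "N \<ge> 2 * K" for N
  proof -
    have "real N / 2 \<le> real (card {Suc K..N})" using N by simp
    also have "\<dots> \<le> (\<Sum>k\<in>{Suc K..N}. (a k)\<^sup>2)"
      using sum_mono[of "{Suc K..N}" "\<lambda>_. 1" "\<lambda>k. (a k)\<^sup>2"] K by (simp add: one_le_power)
    also have "\<dots> \<le> (\<Sum>k=1..N. (a k)\<^sup>2)" by (rule sum_mono2) auto
    finally show ?thesis .
  qed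
  then show ?thesis unfolding eventually_sequentially by blast
qed

text \<open>The normalized sum is normal with variance \<open>s\<^sup>2 / S N\<close>, where \<open>S N\<close> is the sum of the squared weights and
  grows at least linearly. Second moments of order \<open>1 / N\<close> need not be summable, but fourth moments of order
  \<open>1 / N\<^sup>2\<close> are. A series of nonnegative variables with summable expectations converges almost surely, so
  its terms tend to 0.\<close>

lemma (in prob_space) weighted_normal_strong_law:
  fixes a :: "nat \<Rightarrow> real"
  assumes normal: "\<And>k. 1 \<le> k \<Longrightarrow> distributed M lborel (X k) (\<lambda>x. ennreal (normal_density 0 s x))"
    and s: "0 < s" and ind: "indep_vars (\<lambda>_. borel) X {1..}"
    and a: "\<And>k. 1 \<le> k \<Longrightarrow> 0 < a k" "\<forall>\<^sub>F k in sequentially. 1 \<le> a k"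
  shows "AE \<omega> in M. (\<lambda>N. (\<Sum>k=1..N. a k * X k \<omega>) / (\<Sum>k=1..N. (a k)\<^sup>2)) \<longlonglongrightarrow> 0"
proof -
  define S where "S N = (\<Sum>k=1..N. (a k)\<^sup>2)" for N
  define D where "D N \<omega> = (\<Sum>k=1..N. a k * X k \<omega>)" for N \<omega>
  have X_meas: "X k \<in> borel_measurable M" if "1 \<le> k" for k
    using distributed_measurable[OF normal[OF that]] by simp
  then have D_meas [measurable]: "D N \<in> borel_measurable M" for N
    unfolding D_def[abs_def] by (intro borel_measurable_sum borel_measurable_times) auto
  have S_nonneg: "0 \<le> S N" for N by (simp add: S_def sum_nonneg)
  have fourth: "(\<integral>\<^sup>+\<omega>. ennreal ((D N \<omega> / S N) ^ 4) \<partial>M) = ennreal (3 * s ^ 4 / (S N)\<^sup>2)" for N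
  \<comment> \<open>For \<open>N = 0\<close> both sides are 0, because \<open>0 / 0 = 0\<close>.\<close>
  proof (cases "N = 0")
    case True
    then show ?thesis by (simp add: D_def S_def)
  next
    case False
    have "S N > 0" unfolding S_def using False a(1) by (intro sum_pos zero_less_power) auto
    have "distributed M lborel (\<lambda>\<omega>. \<Sum>k\<in>{1..N}. a k * X k \<omega>)
      (normal_density (\<Sum>k\<in>{1..N}. 0) (sqrt (\<Sum>k\<in>{1..N}. (a k * s)\<^sup>2)))"
    proof (rule sum_indep_normal)
      show "indep_vars (\<lambda>_. borel) (\<lambda>k \<omega>. a k * X k \<omega>) {1..N}"
        using indep_vars_subset[OF ind, of "{1..N}"] False
        by (intro indep_vars_compose2[where Y = "\<lambda>k x. a k * x"]) auto
      show "distributed M lborel (\<lambda>\<omega>. a k * X k \<omega>) (normal_density 0 (a k * s))" if "k \<in> {1..N}" for k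
        using normal_density_affine[OF normal s, of k "a k" 0] a(1)[of k] that by simp
    qed (use False a(1) s in auto)
    moreover have "sqrt (\<Sum>k\<in>{1..N}. (a k * s)\<^sup>2) = s * sqrt (S N)"
      using s by (simp add: S_def power_mult_distrib sum_distrib_right[symmetric] real_sqrt_mult)
    ultimately have "distributed M lborel (D N) (\<lambda>x. ennreal (normal_density 0 (s * sqrt (S N)) x))"
      by (simp add: D_def[abs_def])
    then have "has_bochner_integral M (\<lambda>\<omega>. (D N \<omega>) ^ 4) (3 * (s * sqrt (S N)) ^ 4)"
      using s \<open>S N > 0\<close> by (intro normal_moments(5)) auto
    from has_bochner_integral_divide_zero[OF this, of "(S N) ^ 4"]
    have "has_bochner_integral M (\<lambda>\<omega>. (D N \<omega> / S N) ^ 4) (3 * (s * sqrt (S N)) ^ 4 / (S N) ^ 4)"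
      by (simp add: power_divide)
    moreover have "3 * (s * sqrt (S N)) ^ 4 / (S N) ^ 4 = 3 * s ^ 4 / (S N)\<^sup>2"
    proof -
      have "sqrt (S N) ^ 4 = (S N)\<^sup>2"
        using S_nonneg[of N] by (metis mult_2 numeral_Bit0 power_mult real_sqrt_pow2)
      then show ?thesis
        using \<open>S N > 0\<close> by (simp add: power_mult_distrib field_simps flip: power_add)
    qed
    ultimately show ?thesis
      by (subst nn_integral_eq_integral) (auto simp: has_bochner_integral_iff)
  qed
  have "summable (\<lambda>N. 3 * s ^ 4 / (S N)\<^sup>2)"
  proof (rule summable_comparison_test_ev)
    show "summable (\<lambda>N. 12 * s ^ 4 * inverse ((real N)\<^sup>2))"
      by (intro summable_mult inverse_power_summable) simp
    show "\<forall>\<^sub>F N in sequentially. norm (3 * s ^ 4 / (S N)\<^sup>2) \<le> 12 * s ^ 4 * inverse ((real N)\<^sup>2)"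
      using sum_squares_linear_growth[OF a(2)] eventually_gt_at_top[of 0]
    proof eventually_elim
      case (elim N)
      then have "(real N / 2)\<^sup>2 \<le> (S N)\<^sup>2" by (intro power_mono) (auto simp: S_def)
      then have "3 * s ^ 4 / (S N)\<^sup>2 \<le> 3 * s ^ 4 / (real N / 2)\<^sup>2"
        using elim s by (intro divide_left_mono mult_pos_pos) auto
      then show ?case using s by (simp add: field_simps)
    qed
  qed
  then have "(\<Sum>N. ennreal (3 * s ^ 4 / (S N)\<^sup>2)) \<noteq> \<top>"
    using s by (intro ennreal_suminf_neq_top) auto
  then have "(\<integral>\<^sup>+\<omega>. (\<Sum>N. ennreal ((D N \<omega> / S N) ^ 4)) \<partial>M) \<noteq> \<infinity>"
    by (subst nn_integral_suminf) (simp_all add: fourth)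
  then have "AE \<omega> in M. (\<Sum>N. ennreal ((D N \<omega> / S N) ^ 4)) \<noteq> \<infinity>"
    by (intro nn_integral_PInf_AE) auto
  then show ?thesis
  proof eventually_elim
    case (elim \<omega>)
    then have "summable (\<lambda>N. (D N \<omega> / S N) ^ 4)"
      by (intro summable_suminf_not_top) auto
    then have "(\<lambda>N. (D N \<omega> / S N) ^ 4) \<longlonglongrightarrow> 0" by (rule summable_LIMSEQ_zero)
    then show ?case unfolding D_def S_def by (simp add: power_tendsto_0_iff)
  qed
qed

text \<open>Well-posedness bounds \<open>(q k)\<^sup>2\<close> by a constant multiple of \<open>\<mu> k\<close>, so \<open>(\<mu> k / q k)\<^sup>2\<close> dominates
  a positive multiple of \<open>\<mu> k\<close>.\<close>

lemma mode_weights_eventually_ge_1: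
  fixes \<mu> q :: "nat \<Rightarrow> real"
  assumes mu_pos: "\<forall>k\<ge>1. \<mu> k > 0" and mu_lim: "filterlim \<mu> at_top sequentially"
    and q_pos: "\<forall>k\<ge>1. q k > 0" and \<sigma>: "\<sigma> > 0"
    and well_posed: "\<exists>\<theta>b>0. \<exists>N0. \<exists>c>0. \<forall>k\<ge>N0. 2 * \<theta>b - \<sigma>\<^sup>2 * (q k)\<^sup>2 / \<mu> k \<ge> c"
  shows "\<forall>\<^sub>F k in sequentially. 1 \<le> \<mu> k / q k"
proof -
  obtain \<theta>b N0 c where wp: "\<theta>b > 0" "c > 0" "\<And>k. k \<ge> N0 \<Longrightarrow> 2 * \<theta>b - \<sigma>\<^sup>2 * (q k)\<^sup>2 / \<mu> k \<ge> c"
    using well_posed by blast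
  have "\<forall>\<^sub>F k in sequentially. 2 * \<theta>b / \<sigma>\<^sup>2 \<le> \<mu> k" using mu_lim by (simp add: filterlim_at_top)
  then show ?thesis
    using eventually_ge_at_top[of N0] eventually_ge_at_top[of 1]
  proof eventually_elim
    case (elim k)
    have pos: "0 < \<mu> k" "0 < q k" using elim mu_pos q_pos by auto
    have "\<sigma>\<^sup>2 * (q k)\<^sup>2 / \<mu> k \<le> 2 * \<theta>b" using wp(2) wp(3)[of k] elim by linarith
    then have "\<sigma>\<^sup>2 * (q k)\<^sup>2 \<le> 2 * \<theta>b * \<mu> k" using pos by (simp add: divide_le_eq)
    also have "\<dots> \<le> \<sigma>\<^sup>2 * \<mu> k * \<mu> k"
      using elim \<sigma> pos by (intro mult_right_mono) (auto simp: divide_le_eq mult.commute)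
    finally have "(q k)\<^sup>2 \<le> (\<mu> k)\<^sup>2" using \<sigma> by (simp add: power2_eq_square mult.assoc)
    then have "q k \<le> \<mu> k" using pos by (simp add: power2_le_iff_abs_le)
    then show ?case using pos by simp
  qed
qed

lemma fisher_info_at_top:
  assumes "T > 0" "\<sigma> \<noteq> 0" and ratio: "\<forall>\<^sub>F k in sequentially. 1 \<le> \<mu> k / q k"
  shows "filterlim (fisher_info T \<sigma> \<mu> q) at_top sequentially"
proof -
  have "filterlim (\<lambda>N. T / \<sigma>\<^sup>2 / 2 * real N) at_top sequentially"
    using assms by (intro filterlim_tendsto_pos_mult_at_top[OF tendsto_const] filterlim_real_sequentially) auto
  moreover have "\<forall>\<^sub>F N in sequentially. T / \<sigma>\<^sup>2 / 2 * real N \<le> fisher_info T \<sigma> \<mu> q N"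
    using sum_squares_linear_growth[OF ratio]
  proof eventually_elim
    case (elim N)
    then have "T / \<sigma>\<^sup>2 * (real N / 2) \<le> T / \<sigma>\<^sup>2 * (\<Sum>k=1..N. (\<mu> k / q k)\<^sup>2)"
      using assms by (intro mult_left_mono) auto
    then show ?case by (simp add: fisher_info_def power_divide)
  qed
  ultimately show ?thesis by (rule filterlim_at_top_mono)
qed

text \<open>By the explicit form of the integrals the estimator is \<open>\<theta>\<close> minus \<open>\<sigma> / T\<close> times a normalized weighted sum of the
  independent normal variables \<open>w k T - w k 0\<close>, to which the strong law applies.\<close>

theorem theta_hat_consistent:
  fixes J :: "nat \<Rightarrow> 'a \<Rightarrow> real"
  assumes basis: "stochastic_basis M F"
    and bm: "\<And>k. 1 \<le> k \<Longrightarrow> brownian_motion M F (w k)"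
    and indep: "indep_processes M w {1..}"
    and mu_pos: "\<And>k. 1 \<le> k \<Longrightarrow> 0 < \<mu> k" and q_pos: "\<And>k. 1 \<le> k \<Longrightarrow> 0 < q k"
    and T: "0 < T" and ratio: "\<forall>\<^sub>F k in sequentially. 1 \<le> \<mu> k / q k"
    and u0: "\<And>k. 1 \<le> k \<Longrightarrow> u0 k \<in> borel_measurable (F 0)" "\<And>k. 1 \<le> k \<Longrightarrow> AE \<omega> in M. u0 k \<omega> \<noteq> 0"
    and J: "\<And>k. 1 \<le> k \<Longrightarrow> has_stochastic_integral M F T
       (\<lambda>t \<omega>. 1 / fourier_mode \<sigma> (\<mu> k) (q k) \<theta> (u0 k) (w k) t \<omega>)
       (fourier_mode \<sigma> (\<mu> k) (q k) \<theta> (u0 k) (w k)) (J k)"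
  shows "AE \<omega> in M. (\<lambda>N. theta_hat T \<mu> q J N \<omega>) \<longlonglongrightarrow> \<theta>"
proof -
  interpret prob_space M using basis by (simp add: stochastic_basis_def)
  define X where "X k \<omega> = w k T \<omega> - w k 0 \<omega>" for k \<omega>
  have normal: "distributed M lborel (X k) (\<lambda>x. ennreal (normal_density 0 (sqrt T) x))" if "1 \<le> k" for k
    using bm[OF that] T unfolding brownian_motion_def X_def[abs_def] by force
  have "indep_vars (\<lambda>_. borel) (\<lambda>k \<omega>. (\<lambda>t\<in>{0..}. w k t \<omega>) T - (\<lambda>t\<in>{0..}. w k t \<omega>) 0) {1..}"
    by (rule indep_vars_compose2[OF indep[unfolded indep_processes_def], where Y = "\<lambda>_ \<phi>. \<phi> T - \<phi> 0"],
        intro borel_measurable_diff measurable_component_singleton) (use T in auto)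
  then have ind: "indep_vars (\<lambda>_. borel) X {1..}" using T by (simp add: X_def[abs_def])
  have lln: "AE \<omega> in M. (\<lambda>N. (\<Sum>k=1..N. \<mu> k / q k * X k \<omega>) / (\<Sum>k=1..N. (\<mu> k / q k)\<^sup>2)) \<longlonglongrightarrow> 0"
    using mu_pos q_pos T by (intro weighted_normal_strong_law[OF normal _ ind _ ratio]) auto
  have "AE \<omega> in M. 1 \<le> k \<longrightarrow> J k \<omega> = \<sigma> * q k * X k \<omega> - \<theta> * \<mu> k * T" for k
    using fourier_mode_stochastic_logarithm[OF basis bm T u0 J, of k] by (cases "1 \<le> k") (auto simp: X_def)
  then have "AE \<omega> in M. \<forall>k. 1 \<le> k \<longrightarrow> J k \<omega> = \<sigma> * q k * X k \<omega> - \<theta> * \<mu> k * T"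
    by (simp add: AE_all_countable)
  with lln show ?thesis
  proof eventually_elim
    case (elim \<omega>)
    define S where "S N = (\<Sum>k=1..N. (\<mu> k / q k)\<^sup>2)" for N
    define Y where "Y N = (\<Sum>k=1..N. \<mu> k / q k * X k \<omega>)" for N
    have "theta_hat T \<mu> q J N \<omega> = \<theta> - \<sigma> / T * (Y N / S N)" if N: "1 \<le> N" for N
    proof -
      have "0 < S N"
        unfolding S_def using N mu_pos q_pos by (intro sum_pos zero_less_power divide_pos_pos) auto
      have "(\<Sum>k=1..N. \<mu> k / (q k)\<^sup>2 * J k \<omega>) =
          (\<Sum>k=1..N. \<sigma> * (\<mu> k / q k * X k \<omega>) - \<theta> * T * (\<mu> k / q k)\<^sup>2)"
      proof (intro sum.cong refl)
        fix k assume "k \<in> {1..N}"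
        then have qk: "q k \<noteq> 0" and Jk: "J k \<omega> = \<sigma> * q k * X k \<omega> - \<theta> * \<mu> k * T"
          using elim(2) q_pos[of k] by auto
        show "\<mu> k / (q k)\<^sup>2 * J k \<omega> = \<sigma> * (\<mu> k / q k * X k \<omega>) - \<theta> * T * (\<mu> k / q k)\<^sup>2"
          unfolding Jk using qk by (simp add: field_simps power2_eq_square)
      qed
      also have "\<dots> = \<sigma> * Y N - \<theta> * T * S N"
        by (simp only: sum_subtractf sum_distrib_left[symmetric] Y_def S_def)
      finally have "theta_hat T \<mu> q J N \<omega> = - (\<sigma> * Y N - \<theta> * T * S N) / (T * S N)"
        by (simp add: theta_hat_def S_def power_divide)
      also have "\<dots> = \<theta> - \<sigma> / T * (Y N / S N)"
        using T \<open>0 < S N\<close> by (simp add: field_simps)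
      finally show ?thesis .
    qed
    then have "\<forall>\<^sub>F N in sequentially. \<theta> - \<sigma> / T * (Y N / S N) = theta_hat T \<mu> q J N \<omega>"
      unfolding eventually_sequentially by metis
    moreover have "(\<lambda>N. \<theta> - \<sigma> / T * (Y N / S N)) \<longlonglongrightarrow> \<theta> - \<sigma> / T * 0"
      using elim(1) unfolding Y_def S_def by (intro tendsto_intros)
    ultimately show ?case using Lim_transform_eventually by fastforce
  qed
qed

section \<open>Concentration of the rescaled prior\<close>

lemma prior_ext_measurable:
  assumes "\<rho> \<in> priors"
  shows "prior_ext \<rho> \<in> borel_measurable borel"
proof -
  have "\<rho> \<in> borel_measurable (restrict_space borel {0<..})" using assms by (simp add: priors_def)
  then have "(\<lambda>\<theta>. if 0 < \<theta> then \<rho> \<theta> else 0) \<in> borel_measurable borel"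
    by (subst measurable_If_restrict_space_iff) (simp_all add: greaterThan_def)
  then show ?thesis by (simp add: prior_ext_def[abs_def])
qed

lemma ennreal_tendsto_0_if_eventually_le:
  fixes f g :: "'a \<Rightarrow> ennreal"
  assumes "\<forall>\<^sub>F n in F. f n \<le> g n" "(g \<longlongrightarrow> 0) F"
  shows "(f \<longlongrightarrow> 0) F"
  by (rule tendsto_sandwich[OF _ assms(1) tendsto_const assms(2)]) simp

text \<open>The window \<open>\<bar>x\<bar> \<le> sqrt (I N) d\<close> is chosen so that, once \<open>h N\<close> is within \<open>d\<close> of \<open>\<theta>\<close>, the argument of \<open>r\<close>
  stays within \<open>2 d\<close> of \<open>\<theta>\<close>, where \<open>r\<close> is bounded. The window exhausts the line, and outside of it the two terms
  of the difference are estimated separately.\<close>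

lemma rescaled_density_local_limit:
  fixes r g :: "real \<Rightarrow> real" and I h :: "nat \<Rightarrow> real"
  assumes [measurable]: "r \<in> borel_measurable borel" "g \<in> borel_measurable borel"
    and r: "\<And>y. 0 \<le> r y" and g: "\<And>x. 0 \<le> g x"
    and I: "filterlim I at_top sequentially" and h: "h \<longlonglongrightarrow> \<theta>" and cont: "isCont r \<theta>"
    and g_int: "(\<integral>\<^sup>+x. ennreal (g x * exp (- x\<^sup>2 / 2)) \<partial>lborel) < \<infinity>"
    and d: "0 < d" and bound: "\<And>y. \<bar>y - \<theta>\<bar> < 2 * d \<Longrightarrow> r y \<le> B"
    and tail: "(\<lambda>N. \<integral>\<^sup>+x\<in>{x. \<bar>x\<bar> > sqrt (I N) * d}.
         ennreal (g x * r (h N + x / sqrt (I N)) * exp (- x\<^sup>2 / 2)) \<partial>lborel) \<longlonglongrightarrow> 0"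
  shows "(\<lambda>N. \<integral>\<^sup>+x. ennreal (g x * \<bar>r (h N + x / sqrt (I N)) - r \<theta>\<bar> * exp (- x\<^sup>2 / 2)) \<partial>lborel) \<longlonglongrightarrow> 0"
proof -
  define G where "G x = g x * exp (- x\<^sup>2 / 2)" for x
  have [measurable]: "G \<in> borel_measurable borel" unfolding G_def[abs_def] by measurable
  have G: "0 \<le> G x" for x using g by (simp add: G_def)
  have "(\<integral>\<^sup>+x. ennreal (G x) \<partial>lborel) < \<infinity>" using g_int unfolding G_def .
  then have G_int: "(\<integral>\<^sup>+x. ennreal (c * G x) \<partial>lborel) < \<infinity>" if "0 \<le> c" for c
    using that by (simp add: ennreal_mult' G nn_integral_cmult ennreal_mult_less_top)
  have sqrt_I: "filterlim (\<lambda>N. sqrt (I N)) at_top sequentially"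
    using filterlim_compose[OF sqrt_at_top I] .
  have ev_h: "\<forall>\<^sub>F N in sequentially. \<bar>h N - \<theta>\<bar> < d"
    using tendstoD[OF h d] by (simp add: dist_real_def)
  have ev_pos: "\<forall>\<^sub>F N in sequentially. 0 < sqrt (I N)"
    using I by (simp add: filterlim_at_top_dense)
  have B: "r \<theta> \<le> B" using bound[of \<theta>] d by simp
  \<comment> \<open>The condition on \<open>h N\<close> and \<open>I N\<close> makes the bound by \<open>B\<close> valid for every \<open>N\<close>, not only eventually.\<close>
  define inner where "inner N x = (if \<bar>h N - \<theta>\<bar> < d \<and> 0 < sqrt (I N) \<and> \<bar>x\<bar> \<le> sqrt (I N) * d
      then \<bar>r (h N + x / sqrt (I N)) - r \<theta>\<bar> * G x else 0)" for N x
  define outer where "outer N x = (if \<bar>x\<bar> > sqrt (I N) * d then r \<theta> * G x else 0)" for N x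
  have [measurable]: "inner N \<in> borel_measurable borel" "outer N \<in> borel_measurable borel" for N
    unfolding inner_def[abs_def] outer_def[abs_def] by measurable
  have "(\<lambda>N. \<integral>\<^sup>+x. ennreal (inner N x) \<partial>lborel) \<longlonglongrightarrow> (\<integral>\<^sup>+(x::real). 0 \<partial>lborel)"
  proof (rule nn_integral_dominated_convergence[where w = "\<lambda>x. ennreal (B * G x)"])
    show "AE x in lborel. ennreal (inner N x) \<le> ennreal (B * G x)" for N
    proof (intro AE_I2 ennreal_leI)
      fix x
      have "\<bar>r (h N + x / sqrt (I N)) - r \<theta>\<bar> \<le> B"
        if "\<bar>h N - \<theta>\<bar> < d" "0 < sqrt (I N)" "\<bar>x\<bar> \<le> sqrt (I N) * d"
      proof -
        have "\<bar>x / sqrt (I N)\<bar> \<le> d" using that(2,3) by (simp add: abs_divide divide_le_eq mult.commute)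
        then have "r (h N + x / sqrt (I N)) \<le> B" using that(1) by (intro bound) linarith
        then show ?thesis using B r[of \<theta>] r[of "h N + x / sqrt (I N)"] by linarith
      qed
      then show "inner N x \<le> B * G x"
        using G[of x] B r[of \<theta>] by (auto simp: inner_def intro!: mult_right_mono)
    qed
    show "AE x in lborel. (\<lambda>N. ennreal (inner N x)) \<longlonglongrightarrow> 0"
    proof (intro AE_I2)
      fix x
      have "(\<lambda>N. h N + x / sqrt (I N)) \<longlonglongrightarrow> \<theta> + 0"
        by (intro tendsto_add h real_tendsto_divide_at_top[OF tendsto_const sqrt_I])
      then have "(\<lambda>N. r (h N + x / sqrt (I N))) \<longlonglongrightarrow> r \<theta>"
        using isCont_tendsto_compose[OF cont] by simp
      then have "(\<lambda>N. \<bar>r (h N + x / sqrt (I N)) - r \<theta>\<bar> * G x) \<longlonglongrightarrow> \<bar>r \<theta> - r \<theta>\<bar> * G x"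
        by (intro tendsto_mult tendsto_rabs tendsto_diff tendsto_const)
      then have lim: "(\<lambda>N. \<bar>r (h N + x / sqrt (I N)) - r \<theta>\<bar> * G x) \<longlonglongrightarrow> 0" by simp
      have "(\<lambda>N. inner N x) \<longlonglongrightarrow> 0"
        by (rule tendsto_sandwich[OF always_eventually always_eventually tendsto_const lim])
           (auto simp: inner_def G)
      then show "(\<lambda>N. ennreal (inner N x)) \<longlonglongrightarrow> 0" using tendsto_ennrealI by fastforce
    qed
    show "(\<integral>\<^sup>+x. ennreal (B * G x) \<partial>lborel) < \<infinity>" using B r[of \<theta>] by (intro G_int) linarith
  qed measurable
  moreover have "(\<lambda>N. \<integral>\<^sup>+x. ennreal (outer N x) \<partial>lborel) \<longlonglongrightarrow> (\<integral>\<^sup>+(x::real). 0 \<partial>lborel)"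
  proof (rule nn_integral_dominated_convergence[where w = "\<lambda>x. ennreal (r \<theta> * G x)"])
    show "AE x in lborel. ennreal (outer N x) \<le> ennreal (r \<theta> * G x)" for N
      using G r by (intro AE_I2 ennreal_leI) (auto simp: outer_def)
    show "AE x in lborel. (\<lambda>N. ennreal (outer N x)) \<longlonglongrightarrow> 0"
    proof (intro AE_I2 tendsto_eventually)
      fix x
      have "\<forall>\<^sub>F N in sequentially. \<bar>x\<bar> / d < sqrt (I N)"
        using sqrt_I by (simp add: filterlim_at_top_dense)
      then show "\<forall>\<^sub>F N in sequentially. ennreal (outer N x) = 0"
        by eventually_elim (use d in \<open>auto simp: outer_def divide_less_eq\<close>)
    qed
    show "(\<integral>\<^sup>+x. ennreal (r \<theta> * G x) \<partial>lborel) < \<infinity>" using r by (rule G_int)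
  qed measurable
  ultimately have lim: "(\<lambda>N. (\<integral>\<^sup>+x. ennreal (inner N x) \<partial>lborel) + ((\<integral>\<^sup>+x. ennreal (outer N x) \<partial>lborel) +
      (\<integral>\<^sup>+x\<in>{x. \<bar>x\<bar> > sqrt (I N) * d}. ennreal (g x * r (h N + x / sqrt (I N)) * exp (- x\<^sup>2 / 2)) \<partial>lborel)))
      \<longlonglongrightarrow> 0"
    using tendsto_add[OF _ tendsto_add[OF _ tail]] by fastforce
  have "\<forall>\<^sub>F N in sequentially.
    (\<integral>\<^sup>+x. ennreal (g x * \<bar>r (h N + x / sqrt (I N)) - r \<theta>\<bar> * exp (- x\<^sup>2 / 2)) \<partial>lborel) \<le>
    (\<integral>\<^sup>+x. ennreal (inner N x) \<partial>lborel) + ((\<integral>\<^sup>+x. ennreal (outer N x) \<partial>lborel) +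
      (\<integral>\<^sup>+x\<in>{x. \<bar>x\<bar> > sqrt (I N) * d}. ennreal (g x * r (h N + x / sqrt (I N)) * exp (- x\<^sup>2 / 2)) \<partial>lborel))"
    using ev_h ev_pos
  proof eventually_elim
    case (elim N)
    have "ennreal (g x * \<bar>r (h N + x / sqrt (I N)) - r \<theta>\<bar> * exp (- x\<^sup>2 / 2)) \<le>
      ennreal (inner N x) + (ennreal (outer N x) +
       ennreal (g x * r (h N + x / sqrt (I N)) * exp (- x\<^sup>2 / 2)) * indicator {x. \<bar>x\<bar> > sqrt (I N) * d} x)" for x
    proof (cases "\<bar>x\<bar> > sqrt (I N) * d")
      case True
      let ?y = "h N + x / sqrt (I N)"
      have "\<bar>r ?y - r \<theta>\<bar> * G x \<le> (r \<theta> + r ?y) * G x"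
        using r[of ?y] r[of \<theta>] by (intro mult_right_mono G) linarith
      then have "ennreal (g x * \<bar>r ?y - r \<theta>\<bar> * exp (- x\<^sup>2 / 2)) \<le>
          ennreal (r \<theta> * G x + g x * r ?y * exp (- x\<^sup>2 / 2))"
        by (intro ennreal_leI) (simp add: G_def algebra_simps)
      also have "\<dots> = ennreal (r \<theta> * G x) + ennreal (g x * r ?y * exp (- x\<^sup>2 / 2))"
        using r g G by (intro ennreal_plus) auto
      finally show ?thesis using True by (simp add: inner_def outer_def)
    next
      case False
      then show ?thesis using elim by (simp add: inner_def outer_def G_def mult_ac)
    qed
    then have "(\<integral>\<^sup>+x. ennreal (g x * \<bar>r (h N + x / sqrt (I N)) - r \<theta>\<bar> * exp (- x\<^sup>2 / 2)) \<partial>lborel) \<le>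
      (\<integral>\<^sup>+x. (ennreal (inner N x) + (ennreal (outer N x) +
       ennreal (g x * r (h N + x / sqrt (I N)) * exp (- x\<^sup>2 / 2)) * indicator {x. \<bar>x\<bar> > sqrt (I N) * d} x)) \<partial>lborel)"
      by (intro nn_integral_mono)
    also have "\<dots> = (\<integral>\<^sup>+x. ennreal (inner N x) \<partial>lborel) + ((\<integral>\<^sup>+x. ennreal (outer N x) \<partial>lborel) +
      (\<integral>\<^sup>+x\<in>{x. \<bar>x\<bar> > sqrt (I N) * d}. ennreal (g x * r (h N + x / sqrt (I N)) * exp (- x\<^sup>2 / 2)) \<partial>lborel))"
      by (simp add: nn_integral_add)
    finally show ?case .
  qed
  then show ?thesis
    using lim by (rule ennreal_tendsto_0_if_eventually_le)
qed

text \<open>In the original variable \<open>y = h N + x / sqrt (I N)\<close> the integration is over \<open>\<bar>y - h N\<bar> > d\<close>. As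
  \<open>(y - h0)\<^sup>2 \<le> 2 (y - h N)\<^sup>2 + 2 (h N - h0)\<^sup>2\<close>, once \<open>I N > 2 I0\<close> the Gaussian factor
  \<open>exp (- I N (y - h N)\<^sup>2 / 2)\<close> is there at most
  \<open>exp (- I0 (y - h0)\<^sup>2 / 2)\<close> times \<open>exp (- I N d\<^sup>2 / 2)\<close>, up to a bounded factor. This exponential decay
  beats the factor \<open>sqrt (I N)\<close> produced by the substitution.\<close>

lemma gaussian_tail_of_integrable_density:
  fixes r :: "real \<Rightarrow> real" and I h :: "nat \<Rightarrow> real"
  assumes [measurable]: "r \<in> borel_measurable borel" and r: "\<And>y. 0 \<le> r y"
    and I: "filterlim I at_top sequentially" and h: "h \<longlonglongrightarrow> \<theta>" and I0: "0 \<le> I0"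
    and fin: "(\<integral>\<^sup>+y. ennreal (exp (- I0 * (y - h0)\<^sup>2 / 2) * r y) \<partial>lborel) < \<infinity>" and d: "0 < d"
  shows "(\<lambda>N. \<integral>\<^sup>+x\<in>{x. \<bar>x\<bar> > sqrt (I N) * d}.
      ennreal (r (h N + x / sqrt (I N)) * exp (- x\<^sup>2 / 2)) \<partial>lborel) \<longlonglongrightarrow> 0"
proof -
  define K where "K = (\<integral>\<^sup>+y. ennreal (exp (- I0 * (y - h0)\<^sup>2 / 2) * r y) \<partial>lborel)"
  define C where "C N = sqrt (I N) * exp (- I N * d\<^sup>2 / 2) * exp (I0 * d\<^sup>2 + I0 * (h N - h0)\<^sup>2)" for N
  have "((\<lambda>x. sqrt x * exp (- x * d\<^sup>2 / 2)) \<longlongrightarrow> 0) at_top"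
    using d by real_asymp
  then have "(\<lambda>N. sqrt (I N) * exp (- I N * d\<^sup>2 / 2)) \<longlonglongrightarrow> 0"
    using I by (rule filterlim_compose)
  then have "C \<longlonglongrightarrow> 0 * exp (I0 * d\<^sup>2 + I0 * (\<theta> - h0)\<^sup>2)"
    unfolding C_def[abs_def] by (intro tendsto_mult[OF _ tendsto_exp] tendsto_intros h)
  then have "(\<lambda>N. ennreal (C N)) \<longlonglongrightarrow> ennreal 0" by (intro tendsto_ennrealI) simp
  then have "(\<lambda>N. K * ennreal (C N)) \<longlonglongrightarrow> K * ennreal 0"
    using fin by (intro ennreal_tendsto_cmult) (auto simp: K_def)
  then have lim: "(\<lambda>N. K * ennreal (C N)) \<longlonglongrightarrow> 0" by simp
  have "\<forall>\<^sub>F N in sequentially. 2 * I0 < I N \<and> 0 < I N"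
    using I by (simp add: filterlim_at_top_dense eventually_conj)
  then have "\<forall>\<^sub>F N in sequentially. (\<integral>\<^sup>+x\<in>{x. \<bar>x\<bar> > sqrt (I N) * d}.
      ennreal (r (h N + x / sqrt (I N)) * exp (- x\<^sup>2 / 2)) \<partial>lborel) \<le> K * ennreal (C N)"
  proof eventually_elim
    case (elim N)
    define c where "c = sqrt (I N)"
    have c: "0 < c" "c\<^sup>2 = I N" using elim by (simp_all add: c_def)
    have "(\<integral>\<^sup>+x\<in>{x. \<bar>x\<bar> > c * d}. ennreal (r (h N + x / c) * exp (- x\<^sup>2 / 2)) \<partial>lborel) =
      ennreal c * (\<integral>\<^sup>+y. ennreal (r (h N + (- (c * h N) + c * y) / c) * exp (- (- (c * h N) + c * y)\<^sup>2 / 2))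
        * indicator {x. \<bar>x\<bar> > c * d} (- (c * h N) + c * y) \<partial>lborel)"
      using c by (subst nn_integral_real_affine[of _ c "- (c * h N)"]) auto
    also have "\<dots> \<le> ennreal c * (\<integral>\<^sup>+y. ennreal (exp (- I N * d\<^sup>2 / 2) * exp (I0 * d\<^sup>2 + I0 * (h N - h0)\<^sup>2)) *
          ennreal (exp (- I0 * (y - h0)\<^sup>2 / 2) * r y) \<partial>lborel)"
    proof (intro mult_left_mono nn_integral_mono)
      fix y
      have y: "h N + (- (c * h N) + c * y) / c = y" using c by (simp add: field_simps)
      have e: "(- (c * h N) + c * y)\<^sup>2 = I N * (y - h N)\<^sup>2"
        unfolding c(2)[symmetric] by (simp add: power2_eq_square algebra_simps)
      have far: "d\<^sup>2 \<le> (y - h N)\<^sup>2" if "\<bar>- (c * h N) + c * y\<bar> > c * d"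
      proof -
        have "- (c * h N) + c * y = c * (y - h N)" by (simp add: algebra_simps)
        then have "c * \<bar>y - h N\<bar> > c * d" using that c by (simp add: abs_mult)
        then have "d < \<bar>y - h N\<bar>" using c by simp
        then show ?thesis using d abs_le_square_iff[of d "y - h N"] by simp
      qed
      have ex: "- (I N * (y - h N)\<^sup>2) / 2 \<le> - I N * d\<^sup>2 / 2 + (I0 * d\<^sup>2 + I0 * (h N - h0)\<^sup>2) + - I0 * (y - h0)\<^sup>2 / 2"
        if "d\<^sup>2 \<le> (y - h N)\<^sup>2"
      proof -
        have "(y - h0)\<^sup>2 \<le> 2 * (y - h N)\<^sup>2 + 2 * (h N - h0)\<^sup>2"
        proof -
          have "2 * (y - h N)\<^sup>2 + 2 * (h N - h0)\<^sup>2 - (y - h0)\<^sup>2 = ((y - h N) - (h N - h0))\<^sup>2"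
            by (simp add: power2_eq_square algebra_simps)
          then show ?thesis using zero_le_power2[of "(y - h N) - (h N - h0)"] by linarith
        qed
        then have 1: "I0 * (y - h0)\<^sup>2 \<le> I0 * (2 * (y - h N)\<^sup>2 + 2 * (h N - h0)\<^sup>2)"
          using I0 by (rule mult_left_mono)
        have "(I N / 2 - I0) * d\<^sup>2 \<le> (I N / 2 - I0) * (y - h N)\<^sup>2"
          using that elim by (intro mult_left_mono) auto
        then show ?thesis using 1 by (simp add: algebra_simps)
      qed
      show "ennreal (r (h N + (- (c * h N) + c * y) / c) * exp (- (- (c * h N) + c * y)\<^sup>2 / 2))
        * indicator {x. \<bar>x\<bar> > c * d} (- (c * h N) + c * y) \<le>
        ennreal (exp (- I N * d\<^sup>2 / 2) * exp (I0 * d\<^sup>2 + I0 * (h N - h0)\<^sup>2)) *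
          ennreal (exp (- I0 * (y - h0)\<^sup>2 / 2) * r y)"
      proof (cases "\<bar>- (c * h N) + c * y\<bar> > c * d")
        case True
        have "exp (- (I N * (y - h N)\<^sup>2) / 2) * r y \<le> exp (- I N * d\<^sup>2 / 2) * exp (I0 * d\<^sup>2 + I0 * (h N - h0)\<^sup>2)
            * exp (- I0 * (y - h0)\<^sup>2 / 2) * r y"
          unfolding exp_add[symmetric] using ex[OF far[OF True]] r by (intro mult_right_mono) auto
        then show ?thesis
          using True r[of y] unfolding y e
          by (subst ennreal_mult[symmetric]) (auto simp: mult_ac intro!: ennreal_leI)
      qed simp
    qed simp
    also have "\<dots> = ennreal c * (ennreal (exp (- I N * d\<^sup>2 / 2) * exp (I0 * d\<^sup>2 + I0 * (h N - h0)\<^sup>2)) * K)"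
      unfolding K_def by (subst nn_integral_cmult) auto
    also have "\<dots> = K * ennreal (C N)"
      using c by (simp add: C_def c_def ennreal_mult mult_ac)
    finally show ?case unfolding c_def .
  qed
  then show ?thesis
    using lim by (rule ennreal_tendsto_0_if_eventually_le)
qed

lemma gaussian_integral:
  "(\<integral>x. exp (- x\<^sup>2 / 2) \<partial>lborel) = sqrt (2 * pi)" "integrable lborel (\<lambda>x::real. exp (- x\<^sup>2 / 2))"
proof -
  have e: "exp (- x\<^sup>2 / 2) = sqrt (2 * pi) * std_normal_density x" for x :: real
    by (simp add: std_normal_density_def)
  show "integrable lborel (\<lambda>x::real. exp (- x\<^sup>2 / 2))"
    unfolding e by simp
  show "(\<integral>x. exp (- x\<^sup>2 / 2) \<partial>lborel) = sqrt (2 * pi)"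
    unfolding e by simp
qed

text \<open>The normalizing constant is a Bochner integral, which is 0 by convention for a non-integrable function.
  The hypothesis excludes this for large \<open>N\<close>, since it makes the integral of the difference finite.\<close>

lemma posterior_const_limit:
  fixes \<rho> :: "real \<Rightarrow> real" and I h :: "nat \<Rightarrow> real"
  assumes [measurable]: "prior_ext \<rho> \<in> borel_measurable borel"
    and lim: "(\<lambda>N. \<integral>\<^sup>+x. ennreal (\<bar>prior_ext \<rho> (h N + x / sqrt (I N)) - b\<bar> * exp (- x\<^sup>2 / 2)) \<partial>lborel) \<longlonglongrightarrow> 0"
  shows "(\<lambda>N. posterior_const \<rho> (I N) (h N)) \<longlonglongrightarrow> b * sqrt (2 * pi)"
proof -
  let ?L = "\<lambda>N. \<integral>\<^sup>+x. ennreal (\<bar>prior_ext \<rho> (h N + x / sqrt (I N)) - b\<bar> * exp (- x\<^sup>2 / 2)) \<partial>lborel"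
  have "\<forall>\<^sub>F N in sequentially. ?L N < \<infinity>"
    using lim by (rule order_tendstoD) simp
  then have "\<forall>\<^sub>F N in sequentially. ennreal (norm (posterior_const \<rho> (I N) (h N) - b * sqrt (2 * pi))) \<le> ?L N"
  proof eventually_elim
    case (elim N)
    let ?d = "\<lambda>x. (prior_ext \<rho> (h N + x / sqrt (I N)) - b) * exp (- x\<^sup>2 / 2)"
    have int: "integrable lborel ?d"
      using elim by (intro integrableI_bounded) (auto simp: abs_mult)
    have b: "integrable lborel (\<lambda>x. b * exp (- x\<^sup>2 / 2))" using gaussian_integral(2) by simp
    have "posterior_const \<rho> (I N) (h N) = (\<integral>x. ?d x + b * exp (- x\<^sup>2 / 2) \<partial>lborel)"
      by (simp add: posterior_const_def algebra_simps)
    also have "\<dots> = (\<integral>x. ?d x \<partial>lborel) + b * sqrt (2 * pi)"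
      unfolding Bochner_Integration.integral_add[OF int b]
      by (simp only: integral_mult_right_zero gaussian_integral(1))
    finally have "posterior_const \<rho> (I N) (h N) - b * sqrt (2 * pi) = (\<integral>x. ?d x \<partial>lborel)" by simp
    then show ?case using integral_norm_bound_ennreal[OF int] by (simp add: abs_mult)
  qed
  then have "(\<lambda>N. ennreal (norm (posterior_const \<rho> (I N) (h N) - b * sqrt (2 * pi)))) \<longlonglongrightarrow> 0"
    using lim by (rule ennreal_tendsto_0_if_eventually_le)
  then have "(\<lambda>N. norm (posterior_const \<rho> (I N) (h N) - b * sqrt (2 * pi))) \<longlonglongrightarrow> 0"
    by (subst (asm) ennreal_tendsto_0_iff) auto
  then show ?thesis by (rule LIM_zero_cancel[OF tendsto_norm_zero_cancel])
qed

text \<open>With \<open>\<rho>\<^sub>N\<close> for the rescaled prior, \<open>C\<close> for the normalizing constant and \<open>e\<close> for \<open>exp (- x\<^sup>2 / 2)\<close>, the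
  integrand is, for large \<open>N\<close>, at most \<open>f\<close> times \<open>\<bar>\<rho>\<^sub>N - \<rho> \<theta>\<bar> e / C + \<bar>\<rho> \<theta> / C - 1 / sqrt (2 \<pi>)\<bar> e\<close>. The first term vanishes by
  \<open>rescaled_density_local_limit\<close>, the second because \<open>C\<close> tends to \<open>\<rho> \<theta> sqrt (2 \<pi>)\<close>.\<close>

theorem bernstein_von_mises_deterministic:
  fixes \<rho> f :: "real \<Rightarrow> real" and I h :: "nat \<Rightarrow> real"
  assumes r_meas [measurable]: "prior_ext \<rho> \<in> borel_measurable borel" and r: "\<And>y. 0 \<le> prior_ext \<rho> y"
    and f_meas [measurable]: "f \<in> borel_measurable borel" and f: "\<And>x. 0 \<le> f x"
    and I: "filterlim I at_top sequentially" and h: "h \<longlonglongrightarrow> \<theta>"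
    and cont: "isCont (prior_ext \<rho>) \<theta>" and pos: "0 < prior_ext \<rho> \<theta>"
    and f_int: "(\<integral>\<^sup>+x. ennreal (f x * exp (- x\<^sup>2 / 2)) \<partial>lborel) < \<infinity>"
    and I0: "0 \<le> I0" and fin: "posterior_denom \<rho> I0 h0 < \<infinity>"
    and d: "0 < d" and bound: "\<And>y. \<bar>y - \<theta>\<bar> < 2 * d \<Longrightarrow> prior_ext \<rho> y \<le> B"
    and tail: "(\<lambda>N. \<integral>\<^sup>+x\<in>{x. \<bar>x\<bar> > sqrt (I N) * d}.
         ennreal (f x * prior_ext \<rho> (h N + x / sqrt (I N)) * exp (- x\<^sup>2 / 2)) \<partial>lborel) \<longlonglongrightarrow> 0"
  shows "(\<lambda>N. \<integral>\<^sup>+x. ennreal (f x * \<bar>posterior_normalized \<rho> (I N) (h N) x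
           - exp (- x\<^sup>2 / 2) / sqrt (2 * pi)\<bar>) \<partial>lborel) \<longlonglongrightarrow> 0"
proof -
  define c where "c = prior_ext \<rho> \<theta> * sqrt (2 * pi)"
  have c: "0 < c" using pos by (simp add: c_def)
  define C where "C N = posterior_const \<rho> (I N) (h N)" for N
  define L where "L N = (\<integral>\<^sup>+x. ennreal (f x * \<bar>prior_ext \<rho> (h N + x / sqrt (I N)) - prior_ext \<rho> \<theta>\<bar>
      * exp (- x\<^sup>2 / 2)) \<partial>lborel)" for N
  have L: "L \<longlonglongrightarrow> 0"
    unfolding L_def[abs_def]
    by (rule rescaled_density_local_limit[OF r_meas f_meas r f I h cont f_int d bound tail])
  have "(\<integral>\<^sup>+y. ennreal (exp (- I0 * (y - h0)\<^sup>2 / 2) * prior_ext \<rho> y) \<partial>lborel) = posterior_denom \<rho> I0 h0"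
    unfolding posterior_denom_def by (intro nn_integral_cong) (simp add: prior_ext_def)
  then have fin': "(\<integral>\<^sup>+y. ennreal (exp (- I0 * (y - h0)\<^sup>2 / 2) * prior_ext \<rho> y) \<partial>lborel) < \<infinity>"
    using fin by simp
  have one: "(\<integral>\<^sup>+(x::real). ennreal (1 * exp (- x\<^sup>2 / 2)) \<partial>lborel) < \<infinity>"
    using gaussian_integral(2) by (simp add: integrable_iff_bounded)
  have one_tail: "(\<lambda>N. \<integral>\<^sup>+x\<in>{x. \<bar>x\<bar> > sqrt (I N) * d}.
      ennreal (1 * prior_ext \<rho> (h N + x / sqrt (I N)) * exp (- x\<^sup>2 / 2)) \<partial>lborel) \<longlonglongrightarrow> 0"
    using gaussian_tail_of_integrable_density[OF r_meas r I h I0 fin' d] by (simp only: mult_1_left)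
  have "(\<lambda>N. \<integral>\<^sup>+x. ennreal (1 * \<bar>prior_ext \<rho> (h N + x / sqrt (I N)) - prior_ext \<rho> \<theta>\<bar>
      * exp (- x\<^sup>2 / 2)) \<partial>lborel) \<longlonglongrightarrow> 0"
    by (rule rescaled_density_local_limit[where g = "\<lambda>_. 1",
        OF r_meas borel_measurable_const r zero_le_one I h cont one d bound one_tail])
  then have C_lim: "C \<longlonglongrightarrow> c"
    unfolding C_def[abs_def] c_def by (intro posterior_const_limit[OF r_meas]) simp
  define k where "k N = \<bar>inverse (C N) * prior_ext \<rho> \<theta> - 1 / sqrt (2 * pi)\<bar>" for N
  have "k \<longlonglongrightarrow> \<bar>inverse c * prior_ext \<rho> \<theta> - 1 / sqrt (2 * pi)\<bar>"
    unfolding k_def[abs_def] using c by (intro tendsto_intros C_lim) auto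
  then have k_lim: "k \<longlonglongrightarrow> 0" using pos by (simp add: c_def field_simps)
  define P where "P = (\<integral>\<^sup>+x. ennreal (f x * exp (- x\<^sup>2 / 2)) \<partial>lborel)"
  have "(\<lambda>N. ennreal (2 / c) * L N + P * ennreal (k N)) \<longlonglongrightarrow> ennreal (2 / c) * 0 + P * ennreal 0"
    using f_int by (intro tendsto_add ennreal_tendsto_cmult L tendsto_ennrealI k_lim) (auto simp: P_def)
  then have lim: "(\<lambda>N. ennreal (2 / c) * L N + P * ennreal (k N)) \<longlonglongrightarrow> 0" by simp
  have "\<forall>\<^sub>F N in sequentially. c / 2 < C N"
    using C_lim c by (intro order_tendstoD) auto
  then have "\<forall>\<^sub>F N in sequentially. (\<integral>\<^sup>+x. ennreal (f x * \<bar>posterior_normalized \<rho> (I N) (h N) x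
           - exp (- x\<^sup>2 / 2) / sqrt (2 * pi)\<bar>) \<partial>lborel) \<le> ennreal (2 / c) * L N + P * ennreal (k N)"
  proof eventually_elim
    case (elim N)
    have C: "0 \<le> inverse (C N)" "inverse (C N) \<le> 2 / c"
      using elim c by (simp_all add: field_simps)
    have "ennreal (f x * \<bar>posterior_normalized \<rho> (I N) (h N) x - exp (- x\<^sup>2 / 2) / sqrt (2 * pi)\<bar>) \<le>
      ennreal (2 / c) * ennreal (f x * \<bar>prior_ext \<rho> (h N + x / sqrt (I N)) - prior_ext \<rho> \<theta>\<bar> * exp (- x\<^sup>2 / 2))
      + ennreal (f x * exp (- x\<^sup>2 / 2)) * ennreal (k N)" for x
    proof -
      define e where "e = exp (- x\<^sup>2 / 2)"
      define y where "y = prior_ext \<rho> (h N + x / sqrt (I N))"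
      define b where "b = prior_ext \<rho> \<theta>"
      have e: "0 \<le> e" by (simp add: e_def)
      have "posterior_normalized \<rho> (I N) (h N) x - e / sqrt (2 * pi) =
          (inverse (C N) * (y - b) + (inverse (C N) * b - 1 / sqrt (2 * pi))) * e"
        by (simp add: posterior_normalized_def C_def y_def b_def e_def algebra_simps)
      also have "\<bar>\<dots>\<bar> \<le> (2 / c * \<bar>y - b\<bar> + k N) * e"
      proof -
        have "\<bar>inverse (C N) * (y - b)\<bar> \<le> 2 / c * \<bar>y - b\<bar>"
          using C unfolding abs_mult by (intro mult_right_mono) auto
        then have "\<bar>inverse (C N) * (y - b) + (inverse (C N) * b - 1 / sqrt (2 * pi))\<bar> \<le> 2 / c * \<bar>y - b\<bar> + k N"
          unfolding k_def b_def by linarith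
        then show ?thesis using e unfolding abs_mult by (simp add: mult_right_mono)
      qed
      finally have "f x * \<bar>posterior_normalized \<rho> (I N) (h N) x - e / sqrt (2 * pi)\<bar>
          \<le> f x * ((2 / c * \<bar>y - b\<bar> + k N) * e)"
        using f by (rule mult_left_mono)
      also have "\<dots> = 2 / c * (f x * \<bar>y - b\<bar> * e) + f x * e * k N" by (simp add: algebra_simps)
      finally have "ennreal (f x * \<bar>posterior_normalized \<rho> (I N) (h N) x - e / sqrt (2 * pi)\<bar>) \<le>
        ennreal (2 / c * (f x * \<bar>y - b\<bar> * e) + f x * e * k N)" by (rule ennreal_leI)
      also have "\<dots> = ennreal (2 / c) * ennreal (f x * \<bar>y - b\<bar> * e) + ennreal (f x * e) * ennreal (k N)"
      proof -
        have "0 \<le> 2 / c * (f x * \<bar>y - b\<bar> * e)" "0 \<le> f x * e * k N" "0 \<le> 2 / c" "0 \<le> f x * e"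
          using f[of x] e c by (simp_all add: k_def)
        then show ?thesis
          using ennreal_plus ennreal_mult'[of "2 / c" "f x * \<bar>y - b\<bar> * e"] ennreal_mult'[of "f x * e" "k N"] by metis
      qed
      finally show ?thesis unfolding e_def y_def b_def .
    qed
    then have "(\<integral>\<^sup>+x. ennreal (f x * \<bar>posterior_normalized \<rho> (I N) (h N) x
           - exp (- x\<^sup>2 / 2) / sqrt (2 * pi)\<bar>) \<partial>lborel) \<le>
      (\<integral>\<^sup>+x. (ennreal (2 / c) * ennreal (f x * \<bar>prior_ext \<rho> (h N + x / sqrt (I N)) - prior_ext \<rho> \<theta>\<bar> * exp (- x\<^sup>2 / 2))
      + ennreal (f x * exp (- x\<^sup>2 / 2)) * ennreal (k N)) \<partial>lborel)"
      by (intro nn_integral_mono)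
    also have "\<dots> = ennreal (2 / c) * L N + P * ennreal (k N)"
      unfolding L_def P_def by (subst nn_integral_add) (auto simp: nn_integral_cmult nn_integral_multc)
    finally show ?case .
  qed
  then show ?thesis
    using lim by (rule ennreal_tendsto_0_if_eventually_le)
qed

section \<open>Convergence of the posterior\<close>

text \<open>The deterministic theorem is applied along almost every trajectory. Its window \<open>d = e / 2\<close> is fixed beforehand,
  from a radius \<open>e\<close> within which the prior differs from its value at \<open>\<theta>0\<close> by less than 1; so the exceptional
  null set of \<open>C2\<close> is the same for all trajectories. The posterior denominator for \<open>N = 1\<close> provides the
  integrability that controls the tails of the prior.\<close>

theorem theorem4p4:
  fixes M :: "'a measure" and F :: "real \<Rightarrow> 'a measure"
    and w :: "nat \<Rightarrow> real \<Rightarrow> 'a \<Rightarrow> real"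
    and \<mu> q :: "nat \<Rightarrow> real" and \<sigma> T \<theta>0 :: real
    and u0 :: "nat \<Rightarrow> 'a \<Rightarrow> real" and u :: "nat \<Rightarrow> real \<Rightarrow> 'a \<Rightarrow> real"
    and J :: "nat \<Rightarrow> 'a \<Rightarrow> real" and I :: "nat \<Rightarrow> real" and \<theta>h :: "nat \<Rightarrow> 'a \<Rightarrow> real"
    and \<rho> f :: "real \<Rightarrow> real"
  assumes basis: "stochastic_basis M F"
    and bm: "\<forall>k\<ge>1. brownian_motion M F (w k)"
    and indep: "indep_processes M w {1..}"
    and mu_pos: "\<forall>k\<ge>1. \<mu> k > 0" and mu_lim: "filterlim \<mu> at_top sequentially"
    and q_pos: "\<forall>k\<ge>1. q k > 0" and sigma_pos: "\<sigma> > 0" and T_pos: "T > 0"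
    and well_posed: "\<exists>\<theta>b>0. \<exists>N0. \<exists>c>0. \<forall>k\<ge>N0. 2 * \<theta>b - \<sigma>\<^sup>2 * (q k)\<^sup>2 / \<mu> k \<ge> c"
    and u0_meas: "\<forall>k\<ge>1. u0 k \<in> borel_measurable (F 0)"
    and u0_nz: "\<forall>k\<ge>1. AE \<omega> in M. u0 k \<omega> \<noteq> 0"
    and theta0: "\<theta>0 > 0"
    and u_def: "\<forall>k. u k = fourier_mode \<sigma> (\<mu> k) (q k) \<theta>0 (u0 k) (w k)"
    and J_int: "\<forall>k\<ge>1. has_stochastic_integral M F T (\<lambda>t \<omega>. 1 / u k t \<omega>) (u k) (J k)"
    and I_def: "I = fisher_info T \<sigma> \<mu> q"
    and thetah_def: "\<theta>h = theta_hat T \<mu> q J"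
    and prior: "\<rho> \<in> priors"
    and denom: "AE \<omega> in M. \<forall>N\<ge>1. 0 < posterior_denom \<rho> (I N) (\<theta>h N \<omega>) \<and>
                                  posterior_denom \<rho> (I N) (\<theta>h N \<omega>) < \<infinity>"
    and prior_nbhd: "\<exists>V. open V \<and> \<theta>0 \<in> V \<and> V \<subseteq> {0<..} \<and> continuous_on V \<rho> \<and> (\<forall>\<theta>\<in>V. \<rho> \<theta> > 0)"
    and f_meas: "f \<in> borel_measurable borel" and f_nonneg: "\<forall>x. f x \<ge> 0"
    and C1: "\<exists>\<alpha>\<in>{0<..<1}. (\<integral>\<^sup>+x. ennreal (f x * exp (- \<alpha> * x\<^sup>2 / 2)) \<partial>lborel) < \<infinity>"
    and C2: "\<forall>\<delta>>0. AE \<omega> in M.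
      (\<lambda>N. \<integral>\<^sup>+x\<in>{x. \<bar>x\<bar> > sqrt (I N) * \<delta>}.
         ennreal (f x * prior_ext \<rho> (\<theta>h N \<omega> + x / sqrt (I N)) * exp (- x\<^sup>2 / 2)) \<partial>lborel)
      \<longlonglongrightarrow> 0"
  shows "AE \<omega> in M.
      (\<lambda>N. \<integral>\<^sup>+x. ennreal (f x * \<bar>posterior_normalized \<rho> (I N) (\<theta>h N \<omega>) x
                                - exp (- x\<^sup>2 / 2) / sqrt (2 * pi)\<bar>) \<partial>lborel)
      \<longlonglongrightarrow> 0"
proof -
  have pos: "T > 0" "\<sigma> > 0" using T_pos sigma_pos by auto
  have ratio: "\<forall>\<^sub>F k in sequentially. 1 \<le> \<mu> k / q k"
    by (rule mode_weights_eventually_ge_1[OF mu_pos mu_lim q_pos sigma_pos well_posed])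
  have I_lim: "filterlim I at_top sequentially"
    unfolding I_def using pos by (intro fisher_info_at_top ratio) auto
  have consistent: "AE \<omega> in M. (\<lambda>N. \<theta>h N \<omega>) \<longlonglongrightarrow> \<theta>0"
    unfolding thetah_def
    using bm mu_pos q_pos u0_meas u0_nz J_int u_def
    by (intro theta_hat_consistent[OF basis _ indep _ _ T_pos ratio, where \<sigma> = \<sigma> and ?u0.0 = u0]) auto
  obtain V where V: "open V" "\<theta>0 \<in> V" "V \<subseteq> {0<..}" "continuous_on V \<rho>" "\<And>\<theta>. \<theta> \<in> V \<Longrightarrow> \<rho> \<theta> > 0"
    using prior_nbhd by blast
  have eq: "prior_ext \<rho> \<theta> = \<rho> \<theta>" if "\<theta> \<in> V" for \<theta> using that V(3) by (auto simp: prior_ext_def)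
  have "continuous_on V (prior_ext \<rho>)" using V(4) eq by (simp cong: continuous_on_cong)
  then have cont: "isCont (prior_ext \<rho>) \<theta>0" using V by (simp add: continuous_on_eq_continuous_at)
  have r_pos: "0 < prior_ext \<rho> \<theta>0" using V by (simp add: eq)
  have r: "0 \<le> prior_ext \<rho> y" for y using prior by (simp add: prior_ext_def priors_def)
  have "prior_ext \<rho> \<midarrow>\<theta>0\<rightarrow> prior_ext \<rho> \<theta>0" using cont by (simp add: isCont_def)
  from LIM_D[OF this zero_less_one] obtain e where e: "e > 0"
    "\<And>y. y \<noteq> \<theta>0 \<and> norm (y - \<theta>0) < e \<Longrightarrow> norm (prior_ext \<rho> y - prior_ext \<rho> \<theta>0) < 1" by blast
  have bound: "prior_ext \<rho> y \<le> prior_ext \<rho> \<theta>0 + 1" if "\<bar>y - \<theta>0\<bar> < 2 * (e / 2)" for y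
    using e(2)[of y] that by (cases "y = \<theta>0") (auto simp: abs_less_iff)
  have f_int: "(\<integral>\<^sup>+x. ennreal (f x * exp (- x\<^sup>2 / 2)) \<partial>lborel) < \<infinity>"
  proof -
    obtain \<alpha> where \<alpha>: "\<alpha> \<in> {0<..<1}" "(\<integral>\<^sup>+x. ennreal (f x * exp (- \<alpha> * x\<^sup>2 / 2)) \<partial>lborel) < \<infinity>"
      using C1 by blast
    have "f x * exp (- x\<^sup>2 / 2) \<le> f x * exp (- \<alpha> * x\<^sup>2 / 2)" for x
    proof (intro mult_left_mono)
      have "\<alpha> * x\<^sup>2 \<le> 1 * x\<^sup>2" using \<alpha>(1) by (intro mult_right_mono) auto
      then show "exp (- x\<^sup>2 / 2) \<le> exp (- \<alpha> * x\<^sup>2 / 2)" by simp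
    qed (use f_nonneg in simp)
    then have "(\<integral>\<^sup>+x. ennreal (f x * exp (- x\<^sup>2 / 2)) \<partial>lborel) \<le>
      (\<integral>\<^sup>+x. ennreal (f x * exp (- \<alpha> * x\<^sup>2 / 2)) \<partial>lborel)"
      by (intro nn_integral_mono ennreal_leI)
    then show ?thesis using \<alpha>(2) by (rule le_less_trans)
  qed
  have I1: "0 \<le> I 1" unfolding I_def fisher_info_def using pos by (simp add: sum_nonneg)
  have "AE \<omega> in M. (\<lambda>N. \<integral>\<^sup>+x\<in>{x. \<bar>x\<bar> > sqrt (I N) * (e / 2)}.
       ennreal (f x * prior_ext \<rho> (\<theta>h N \<omega> + x / sqrt (I N)) * exp (- x\<^sup>2 / 2)) \<partial>lborel) \<longlonglongrightarrow> 0"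
    using C2 half_gt_zero[OF e(1)] by blast
  then show ?thesis
    using consistent denom
  proof eventually_elim
    case (elim \<omega>)
    have fin: "posterior_denom \<rho> (I 1) (\<theta>h 1 \<omega>) < \<infinity>" using elim(3) by simp
    show ?case
      by (rule bernstein_von_mises_deterministic[OF prior_ext_measurable[OF prior] r f_meas _ I_lim elim(2)
            cont r_pos f_int I1 fin half_gt_zero[OF e(1)] bound elim(1)])
         (use f_nonneg in simp)
  qed
qed

end
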